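(* Let $X$ be a finite set of size $N$, $Y=\{0,\dots,M-1\}$, $\mathsf{Func}\subseteq Y^X$. Let $\mathsf F:\mathsf{Func}\to2^\Sigma$ be a problem, $\delta$ an input distribution on $\mathsf{Func}$, $\kappa>1$ a constant, and $\Gamma=\sum_{i=0}^\ell\kappa^i\Lambda_i$ an MLA matrix with $1$-eigenstate $|\delta\rangle$. Let $\lambda$ be real with $1<\lambda\le\kappa^\ell$, and let $\Lambda_{\mathsf{bad}}$ be the projector onto the eigenspaces of $\Gamma$ corresponding to eigenvalues smaller than $\lambda$. Let $0\le\epsilon\le1$ and let $\eta\le1-\epsilon$ be a positive constant such that $\|F_z\Lambda_{\mathsf{bad}}\|^2\le\eta$ for every $z\in\Sigma$, where $F_z=\sum_{f\in\mathsf{Func}:\,z\in\mathsf F(f)}|f\rangle\langle f|$. Then: 1. For any quantum query algorithm $\mathcal A$, $W^0(\Gamma,\mathcal A)=1$. 2. For any $T$-query quantum algorithm $\mathcal A$ and $t\in\{0,\dots,T-1\}$, $$\frac{W^{t+1}(\Gamma,\mathcal A)}{W^t(\Gamma,\mathcal A)}\le\Big(1+\max_{i\in\{0,\dots,\ell-1\},\,x\in X,\,y\in Y}\frac{\kappa-1}{\sqrt\kappa}\big\|\Lambda_{i+1}\Pi_{\le t+1}\mathcal O_{x,y}\Pi_{\le t}\Lambda_i\big\|\Big)^2.$$ 3. For any $T$-query quantum algorithm $\mathcal A$ that solves $\mathsf F$ on input $|\delta\rangle$ with success probability at least $1-\epsilon$, $$W^T(\Gamma,\mathcal A)\ge1+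(\lambda-1)(\sqrt{1-\epsilon}-\sqrt\eta)^2.$$
   Context: Notation: $[n]=\{1,\dots,n\}$, $[n]_0=\{0,\dots,n\}$; $\mathbb C[S]$ is the Hilbert space with orthonormal basis $\{|s\rangle:s\in S\}$; $\|\cdot\|$ is the operator norm. $\mathsf F(f)\subseteq\Sigma$ is the set of valid outputs on input $f$. Oracle. For $x\in X$, $y\in Y$, $\mathcal O_{x,y}$ is the diagonal unitary on $\mathbb C[\mathsf{Func}]$ (register $\mathcal I$) with $\mathcal O_{x,y}|f\rangle=e^{\frac{2\pi i}{M}yf(x)}|f\rangle$. The purified oracle is $\mathcal O|x\rangle_{\mathcal X}|y\rangle_{\mathcal Y}|f\rangle_{\mathcal I}=|x\rangle|(y+f(x))\bmod M\rangle|f\rangle$; equivalently $\mathcal O=\sum_{x,y}|x\rangle\langle x|\otimes|\hat y\rangle\langle\hat y|\otimes\mathcal O_{x,y}$ up to the sign convention for the Fourier basis $|\hat y\rangle=\frac1{\sqrt M}\sum_{z\in Y}e^{\frac{2\pi i}{M}yz}|z\rangle$ (i.e. up to relabelling $y\mapsto-y\bmod M$). Algorithm. A $T$-query quantum algorithm $\mathcal A$ is a sequence of unitaries $U_0,\dots,U_T$ on $\mathbb C[W\times X\times Y]$ (registers $\mathcal W\mathcal X\mathcal Y$) for some finite set $W$. With $|\delta\rangle=\sum_f\sqrt{\delta(f)}|f\rangle_{\mathcal I}$, its state after $t$ queries is $|\psi_t\rangle=U_t\mathcal OU_{t-1}\mathcal O\cdots\mathcal OU_0|0\rangle_{\mathcal{WXY}}|\delta\rangle_{\mathcal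 I}$ (operators tensored with identities), where $|0\rangle$ is a fixed basis state; $\rho^t_{\mathcal I}=\mathrm{Tr}_{\mathcal{WXY}}[|\psi_t\rangle\langle\psi_t|]$ and the progress measure is $W^t(\Gamma,\mathcal A)=\mathrm{Tr}[\Gamma\rho^t_{\mathcal I}]$. The output $z\in\Sigma$ is obtained by measuring a subregister $\mathcal W_O$ of $\mathcal W$ (with basis $\Sigma$) in the state $|\psi_T\rangle$; $\mathcal A$ solves $\mathsf F$ on input $|\delta\rangle$ with success probability at least $1-\epsilon$ if $\big\|\sum_{z\in\Sigma}(|z\rangle\langle z|_{\mathcal W_O}\otimes F_z)|\psi_T\rangle\big\|^2\ge1-\epsilon$. Reachable spaces. For $t\in[N]$, $x_1,\dots,x_t\in X$, $y_1,\dots,y_t\in Y$ put $\alpha_{x_1,\dots,x_t}^{y_1,\dots,y_t}=\sum_{f\in\mathsf{Func}:\,f(x_i)=y_i\,\forall i}\delta(f)$ and, when this is nonzero, $|v_{x_1,\dots,x_t}^{y_1,\dots,y_t}\rangle=(\alpha_{x_1,\dots,x_t}^{y_1,\dots,y_t})^{-1/2}\sum_{f\in\mathsf{Func}:\,f(x_i)=y_i\,\forall i}\sqrt{\delta(f)}|f\rangle$. Let $\mathsf{Space}_0(\delta)=\mathrm{span}\{|\delta\rangle\}$, $\mathsf{Space}_t(\delta)=\mathrm{span}\{|v_{x_1,\dots,x_t}^{y_1,\dots,y_t}\rangle\}$ (over all $x_i\in X,y_i\in Y$) for $t\in[N]$, and $\mathsf{Space}_t(\delta)=\mathsf{Space}_N(\delta)$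 for $t>N$. $\Pi_{\le t}$ is the orthogonal projector onto $\mathsf{Space}_t(\delta)$. MLA matrix. A multiplicative ladder adversary (MLA) matrix (with respect to $\delta$) is a positive definite matrix $\Gamma\in\mathbb C^{\mathsf{Func}\times\mathsf{Func}}$ with smallest eigenvalue $1$ whose spectral decomposition is $\Gamma=\sum_{i=0}^{\ell}\kappa^i\Lambda_i$ for some $\kappa>1$ ($\ell+1$ is the number of distinct eigenvalues, $\Lambda_i$ the projector onto the $\kappa^i$-eigenspace), such that $\Gamma$ commutes with $\Pi_{\le t}$ for all $t\in[N]_0$, and $\|\Lambda_{i'}\mathcal O_{x,y}\Lambda_i\|=0$ for all $x\in X$, $y\in Y$ and all $i,i'\in[\ell]_0$ with $|i'-i|>1$. *)

theory Defs
  imports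
    "HOL-Analysis.Analysis"
    "HOL-Probability.Probability_Mass_Function"
    "HOL-Library.Complex_Order"
    "Berlekamp_Zassenhaus.Finite_Field"
begin

text \<open>
  The Hilbert space \<open>\<complex>[S]\<close> is \<^typ>\<open>complex ^ 's\<close> for a finite index type
  \<open>'s\<close>; a tensor product is indexed by the product type.  The finite sets
  \<open>X\<close>, \<open>W\<close>, \<open>\<Sigma>\<close> are the types \<open>'x\<close>, \<open>'w\<close>, \<open>'z\<close>, with \<open>N = CARD('x)\<close>, and
  \<open>Y = {0, ..., M - 1}\<close> is \<^typ>\<open>'m mod_ring\<close> with \<open>M = CARD('m)\<close>, whose addition is
  addition modulo \<open>M\<close>.

  A nonempty set \<open>Func \<subseteq> Y^X\<close> is given as the range of an injective evaluation map
  \<open>ev :: 'f \<Rightarrow> 'x \<Rightarrow> 'm mod_ring\<close>, where \<open>ev f x\<close> is \<open>f(x)\<close>, so that matrices in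
  \<open>\<complex>^(Func \<times> Func)\<close> have type \<open>complex ^ 'f ^ 'f\<close>.

  On complex numbers, \<open>\<le>\<close> and \<open><\<close> are those of \<^theory>\<open>HOL-Library.Complex_Order\<close>: both
  sides have the same imaginary part and the real parts compare.
\<close>


subsection \<open>Linear algebra\<close>

definition cinner :: "complex ^ 'n::finite \<Rightarrow> complex ^ 'n \<Rightarrow> complex" where
  "cinner u v = (\<Sum>i\<in>UNIV. cnj (u $ i) * v $ i)"

definition cadjoint :: "complex ^ 'n ^ 'm \<Rightarrow> complex ^ 'm ^ 'n" where
  "cadjoint A = (\<chi> i j. cnj (A $ j $ i))"

definition unitary :: "complex ^ 'n::finite ^ 'n \<Rightarrow> bool" where
  "unitary U \<longleftrightarrow> cadjoint U ** U = mat 1 \<and> U ** cadjoint U = mat 1"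

definition pos_def :: "complex ^ 'n::finite ^ 'n \<Rightarrow> bool" where
  "pos_def A \<longleftrightarrow> cadjoint A = A \<and> (\<forall>v. v \<noteq> 0 \<longrightarrow> 0 < cinner v (A *v v))"

definition opnorm :: "complex ^ 'n::finite ^ 'm::finite \<Rightarrow> real" where
  "opnorm A = onorm ((*v) A)"

definition ket :: "'n::finite \<Rightarrow> complex ^ 'n" where
  "ket i = axis i 1"

definition ketbra :: "complex ^ 'm \<Rightarrow> complex ^ 'n \<Rightarrow> complex ^ 'n ^ 'm" where
  "ketbra u v = (\<chi> i j. u $ i * cnj (v $ j))"

definition tensor_vec :: "complex ^ 'a \<Rightarrow> complex ^ 'b \<Rightarrow> complex ^ ('a \<times> 'b)" where
  "tensor_vec u v = (\<chi> p. u $ fst p * v $ snd p)"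

definition tensor_mat ::
  "complex ^ 'a ^ 'a \<Rightarrow> complex ^ 'b ^ 'b \<Rightarrow> complex ^ ('a \<times> 'b) ^ ('a \<times> 'b)" where
  "tensor_mat A B = (\<chi> p q. A $ fst p $ fst q * B $ snd p $ snd q)"

definition partial_trace_fst ::
  "complex ^ ('a::finite \<times> 'b) ^ ('a \<times> 'b) \<Rightarrow> complex ^ 'b ^ 'b" where
  "partial_trace_fst A = (\<chi> i j. \<Sum>a\<in>UNIV. A $ (a, i) $ (a, j))"

definition is_orth_proj :: "(complex ^ 'n::finite) set \<Rightarrow> complex ^ 'n ^ 'n \<Rightarrow> bool" where
  "is_orth_proj S P \<longleftrightarrow> (\<forall>v. P *v v \<in> S \<and> (\<forall>u\<in>S. cinner u (v - P *v v) = 0))"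

definition orth_proj :: "(complex ^ 'n::finite) set \<Rightarrow> complex ^ 'n ^ 'n" where
  "orth_proj S = (THE P. is_orth_proj S P)"

definition eigenspace :: "complex ^ 'n::finite ^ 'n \<Rightarrow> complex \<Rightarrow> (complex ^ 'n) set" where
  "eigenspace A c = {v. A *v v = c *s v}"

definition eigenvalues :: "complex ^ 'n::finite ^ 'n \<Rightarrow> complex set" where
  "eigenvalues A = {c. \<exists>v. v \<noteq> 0 \<and> A *v v = c *s v}"


subsection \<open>Oracle\<close>

definition phase_oracle ::
  "('f::finite \<Rightarrow> 'x \<Rightarrow> 'm::finite mod_ring) \<Rightarrow> 'x \<Rightarrow> 'm mod_ring \<Rightarrow> complex ^ 'f ^ 'f" where
  "phase_oracle ev x y =
    (\<chi> f g. if f = g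
      then exp (2 * pi * \<i> / of_nat CARD('m)
        * of_int (to_int_mod_ring y) * of_int (to_int_mod_ring (ev f x)))
      else 0)"

text \<open>The purified oracle, already tensored with the identity on the workspace \<open>\<W>\<close>.\<close>

definition purified_oracle ::
  "('f::finite \<Rightarrow> 'x::finite \<Rightarrow> 'm::finite mod_ring)
    \<Rightarrow> complex ^ (('w::finite \<times> 'x \<times> 'm mod_ring) \<times> 'f) ^ (('w \<times> 'x \<times> 'm mod_ring) \<times> 'f)" where
  "purified_oracle ev =
    (\<chi> p q. case q of ((w, x, y), f) \<Rightarrow> if p = ((w, x, y + ev f x), f) then 1 else 0)"


subsection \<open>Algorithms\<close>

definition dist_ket :: "'f::finite pmf \<Rightarrow> complex ^ 'f" where
  "dist_ket \<delta> = (\<Sum>f\<in>UNIV. of_real (sqrt (pmf \<delta> f)) *s ket f)"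

text \<open>
  An algorithm is a sequence \<open>U\<close> of unitaries, of which only \<open>U 0, ..., U T\<close> are used, with the
  index \<open>q\<close> of the initial basis state of \<open>\<W>\<X>\<Y>\<close>.
\<close>

definition query_algorithm ::
  "nat \<Rightarrow> (nat \<Rightarrow> complex ^ ('w::finite \<times> 'x::finite \<times> 'm::finite mod_ring)
                        ^ ('w \<times> 'x \<times> 'm mod_ring)) \<Rightarrow> bool" where
  "query_algorithm T U \<longleftrightarrow> (\<forall>t\<le>T. unitary (U t))"

primrec state ::
  "('f::finite \<Rightarrow> 'x::finite \<Rightarrow> 'm::finite mod_ring) \<Rightarrow> 'f pmf
    \<Rightarrow> (nat \<Rightarrow> complex ^ ('w::finite \<times> 'x \<times> 'm mod_ring) ^ ('w \<times> 'x \<times> 'm mod_ring))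
    \<Rightarrow> 'w \<times> 'x \<times> 'm mod_ring \<Rightarrow> nat \<Rightarrow> complex ^ (('w \<times> 'x \<times> 'm mod_ring) \<times> 'f)" where
  "state ev \<delta> U q 0 = tensor_mat (U 0) (mat 1) *v tensor_vec (ket q) (dist_ket \<delta>)"
| "state ev \<delta> U q (Suc t) =
    tensor_mat (U (Suc t)) (mat 1) *v (purified_oracle ev *v state ev \<delta> U q t)"

definition progress ::
  "('f::finite \<Rightarrow> 'x::finite \<Rightarrow> 'm::finite mod_ring) \<Rightarrow> 'f pmf \<Rightarrow> complex ^ 'f ^ 'f
    \<Rightarrow> (nat \<Rightarrow> complex ^ ('w::finite \<times> 'x \<times> 'm mod_ring) ^ ('w \<times> 'x \<times> 'm mod_ring))
    \<Rightarrow> 'w \<times> 'x \<times> 'm mod_ring \<Rightarrow> nat \<Rightarrow> complex" where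
  "progress ev \<delta> \<Gamma> U q t =
    trace (\<Gamma> ** partial_trace_fst (ketbra (state ev \<delta> U q t) (state ev \<delta> U q t)))"

definition valid_proj :: "('f::finite \<Rightarrow> 'z set) \<Rightarrow> 'z \<Rightarrow> complex ^ 'f ^ 'f" where
  "valid_proj F z = (\<Sum>f | z \<in> F f. ketbra (ket f) (ket f))"

text \<open>Here the workspace is \<open>\<Sigma> \<times> 'v\<close>; the first factor is the output register \<open>\<W>\<^sub>O\<close>.\<close>

definition success_proj ::
  "('f::finite \<Rightarrow> 'z::finite set)
    \<Rightarrow> complex ^ ((('z \<times> 'v::finite) \<times> 'x::finite \<times> 'm::finite mod_ring) \<times> 'f)
              ^ ((('z \<times> 'v) \<times> 'x \<times> 'm mod_ring) \<times> 'f)" where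
  "success_proj F = (\<Sum>z\<in>UNIV.
    tensor_mat (tensor_mat (tensor_mat (ketbra (ket z) (ket z)) (mat 1)) (mat 1)) (valid_proj F z))"

definition solves ::
  "('f::finite \<Rightarrow> 'x::finite \<Rightarrow> 'm::finite mod_ring) \<Rightarrow> 'f pmf \<Rightarrow> ('f \<Rightarrow> 'z::finite set)
    \<Rightarrow> nat \<Rightarrow> (nat \<Rightarrow> complex ^ (('z \<times> 'v::finite) \<times> 'x \<times> 'm mod_ring)
                              ^ (('z \<times> 'v) \<times> 'x \<times> 'm mod_ring))
    \<Rightarrow> ('z \<times> 'v) \<times> 'x \<times> 'm mod_ring \<Rightarrow> real \<Rightarrow> bool" where
  "solves ev \<delta> F T U q p \<longleftrightarrow> (norm (success_proj F *v state ev \<delta> U q T))\<^sup>2 \<ge> p"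


subsection \<open>Reachable spaces\<close>

text \<open>The points \<open>x\<^sub>1, ..., x\<^sub>t\<close> and values \<open>y\<^sub>1, ..., y\<^sub>t\<close> are the list of pairs \<open>(x\<^sub>i, y\<^sub>i)\<close>.\<close>

definition consistent ::
  "('f \<Rightarrow> 'x \<Rightarrow> 'm::finite mod_ring) \<Rightarrow> ('x \<times> 'm mod_ring) list \<Rightarrow> 'f set" where
  "consistent ev ps = {f. \<forall>(x, y)\<in>set ps. ev f x = y}"

definition reach_weight ::
  "('f::finite \<Rightarrow> 'x \<Rightarrow> 'm::finite mod_ring) \<Rightarrow> 'f pmf \<Rightarrow> ('x \<times> 'm mod_ring) list \<Rightarrow> real" where
  "reach_weight ev \<delta> ps = (\<Sum>f\<in>consistent ev ps. pmf \<delta> f)"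

definition reach_vec ::
  "('f::finite \<Rightarrow> 'x \<Rightarrow> 'm::finite mod_ring) \<Rightarrow> 'f pmf \<Rightarrow> ('x \<times> 'm mod_ring) list
    \<Rightarrow> complex ^ 'f" where
  "reach_vec ev \<delta> ps =
    of_real (1 / sqrt (reach_weight ev \<delta> ps))
      *s (\<Sum>f\<in>consistent ev ps. of_real (sqrt (pmf \<delta> f)) *s ket f)"

definition reach_space ::
  "('f::finite \<Rightarrow> 'x::finite \<Rightarrow> 'm::finite mod_ring) \<Rightarrow> 'f pmf \<Rightarrow> nat \<Rightarrow> (complex ^ 'f) set" where
  "reach_space ev \<delta> t =
    (if t = 0 then vec.span {dist_ket \<delta>}
     else vec.span {reach_vec ev \<delta> ps |ps.
            length ps = min t CARD('x) \<and> reach_weight ev \<delta> ps \<noteq> 0})"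

definition reach_proj ::
  "('f::finite \<Rightarrow> 'x::finite \<Rightarrow> 'm::finite mod_ring) \<Rightarrow> 'f pmf \<Rightarrow> nat \<Rightarrow> complex ^ 'f ^ 'f" where
  "reach_proj ev \<delta> t = orth_proj (reach_space ev \<delta> t)"


subsection \<open>Multiplicative ladder adversary matrices\<close>

definition mla_matrix ::
  "('f::finite \<Rightarrow> 'x::finite \<Rightarrow> 'm::finite mod_ring) \<Rightarrow> 'f pmf \<Rightarrow> real \<Rightarrow> nat
    \<Rightarrow> (nat \<Rightarrow> complex ^ 'f ^ 'f) \<Rightarrow> complex ^ 'f ^ 'f \<Rightarrow> bool" where
  "mla_matrix ev \<delta> \<kappa> l \<Lambda> \<Gamma> \<longleftrightarrow>
    pos_def \<Gamma> \<and>
    1 \<in> eigenvalues \<Gamma> \<and> (\<forall>c\<in>eigenvalues \<Gamma>. 1 \<le> c) \<and>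
    \<kappa> > 1 \<and>
    eigenvalues \<Gamma> = {of_real (\<kappa> ^ i) |i. i \<le> l} \<and>
    (\<forall>i\<le>l. \<Lambda> i = orth_proj (eigenspace \<Gamma> (of_real (\<kappa> ^ i)))) \<and>
    \<Gamma> = (\<Sum>i\<le>l. (\<kappa> ^ i) *\<^sub>R \<Lambda> i) \<and>
    (\<forall>t\<le>CARD('x). \<Gamma> ** reach_proj ev \<delta> t = reach_proj ev \<delta> t ** \<Gamma>) \<and>
    (\<forall>x y. \<forall>i\<le>l. \<forall>i'\<le>l. \<bar>int i' - int i\<bar> > 1 \<longrightarrow>
      opnorm (\<Lambda> i' ** phase_oracle ev x y ** \<Lambda> i) = 0)"

definition bad_proj :: "complex ^ 'f::finite ^ 'f \<Rightarrow> real \<Rightarrow> complex ^ 'f ^ 'f" where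
  "bad_proj \<Gamma> r =
    orth_proj (vec.span (\<Union>c\<in>{c\<in>eigenvalues \<Gamma>. c < of_real r}. eigenspace \<Gamma> c))"

end

(*
  In the Fourier basis of the query register, a query applies the phase oracles O_{x,y} to the
  slices of the state, and these slices lie in Space_t.  Hence the growth of the progress measure
  is governed by the norm of Gamma^(1/2) O Gamma^(-1/2) on Space_t, for a unitary O that is block
  tridiagonal with respect to the eigenspaces of Gamma.  The hypotheses bound only the upward
  blocks P_i = Lambda_{i+1} O Lambda_i on Space_t.  The downward blocks Q_i = Lambda_i O Lambda_{i+1}
  are not bounded by them on Space_t, but orthogonality of the images O v_i, O v_{i+1} gives
  <P_i v_i, D_{i+1} v_{i+1}> = - <D_i v_i, Q_i v_{i+1}> for the diagonal blocks D_i, so that the cross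
  terms are small unless |Q_i v_{i+1}| is large, in which case the term - |Q_i v_{i+1}|^2 compensates.
  For the last part, the component of the final state in the bad eigenspaces succeeds with
  amplitude at most sqrt(eta), so the complementary component has norm at least
  sqrt(1 - epsilon) - sqrt(eta), and there Gamma is at least lam.
*)
theory Submission
  imports Defs
begin

subsection \<open>The ladder step\<close>

text \<open>In its use \<open>a\<close> and \<open>b\<close> are the norms of the components of the
  vector on two adjacent levels, \<open>q\<close> is the norm of the downward block and
  \<open>x\<close> the cross term. A large \<open>q\<close> pays for the term with
  \<open>b\<^sup>2\<close> by itself. A small \<open>q\<close> sharpens the bound on
  \<open>x\<close>, and the resulting expression grows with \<open>q\<close> because
  \<open>\<mu>\<close> is at most 1 and \<open>s\<close> at least 1.\<close>

lemma off_diagonal_bound: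
  fixes a b q x \<mu> s :: real
  assumes "0 \<le> \<mu>" "\<mu> \<le> 1" "1 \<le> s" "0 \<le> a" "0 \<le> b" "0 \<le> q" "x \<le> a * q" "x \<le> \<mu> * a * b"
  shows "2 * x - q\<^sup>2 \<le> \<mu> * (a\<^sup>2 / s + s * b\<^sup>2) - \<mu>\<^sup>2 * b\<^sup>2"
proof -
  have s0: "s > 0" using assms by linarith
  have amgm: "2 * a * r \<le> a\<^sup>2 / s + s * r\<^sup>2" for r
  proof -
    have "0 \<le> (a - s * r)\<^sup>2 / s" using s0 by simp
    also have "\<dots> = a\<^sup>2 / s + s * r\<^sup>2 - 2 * a * r"
      using s0 by (simp add: field_simps power2_eq_square)
    finally show ?thesis by simp
  qed
  show ?thesis
  proof (cases "\<mu> * b \<le> q")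
    case True
    then have "\<mu>\<^sup>2 * b\<^sup>2 \<le> q\<^sup>2"
      using assms by (metis mult_nonneg_nonneg power_mono power_mult_distrib)
    moreover have "2 * x \<le> \<mu> * (a\<^sup>2 / s + s * b\<^sup>2)"
      using mult_left_mono[OF amgm[of b] \<open>0 \<le> \<mu>\<close>] assms(8) by (simp add: algebra_simps)
    ultimately show ?thesis by linarith
  next
    case False
    then have mu: "\<mu> > 0" using assms by (cases "\<mu> = 0") auto
    \<comment> \<open>Rescaling \<open>q\<close> lets \<open>r\<close> take the place of
      \<open>b\<close> in the weighted AM-GM inequality, with \<open>r\<close> below
      \<open>b\<close> in this case.\<close>
    define r where "r = q / \<mu>"
    have q: "q = \<mu> * r" using mu by (simp add: r_def)
    have rb: "r\<^sup>2 \<le> b\<^sup>2"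
      using False q mu assms by (intro power_mono) (auto simp: zero_le_mult_iff)
    have "2 * x \<le> \<mu> * (a\<^sup>2 / s + s * r\<^sup>2)"
      using mult_left_mono[OF amgm[of r] \<open>0 \<le> \<mu>\<close>] assms(7) q by (simp add: algebra_simps)
    moreover have "\<mu> * (s - \<mu>) * r\<^sup>2 \<le> \<mu> * (s - \<mu>) * b\<^sup>2"
      using rb assms by (intro mult_left_mono) auto
    ultimately show ?thesis unfolding q by (simp add: algebra_simps power2_eq_square)
  qed
qed

text \<open>A real inner product suffices, since only norms and real parts of inner products enter.
  The levels are indexed by all naturals and vanish above \<open>l\<close>, so that neighbouring
  levels can be named without range conditions. The bound \<open>up\<close> is required only for the
  given \<open>v\<close>, because in its application it holds only on a reachable space.\<close>

lemma ladder_step: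
  fixes L :: "nat \<Rightarrow> 'a::real_inner \<Rightarrow> 'a" and V :: "'a \<Rightarrow> 'a" and \<kappa> \<mu> :: real
  assumes linL: "\<And>i. linear (L i)"
    and selfadj: "\<And>i u v. inner (L i u) v = inner u (L i v)"
    and LL: "\<And>i j u. L i (L j u) = (if i = j then L i u else 0)"
    and complete: "\<And>u. (\<Sum>i\<le>l. L i u) = u"
    and beyond: "\<And>i u. i > l \<Longrightarrow> L i u = 0"
    and linV: "linear V"
    and iso: "\<And>u v. inner (V u) (V v) = inner u v"
    and ladder: "\<And>i j u. \<bar>int i - int j\<bar> > 1 \<Longrightarrow> L i (V (L j u)) = 0"
    and kappa: "1 < \<kappa>" and mu: "0 \<le> \<mu>"
    and up: "\<And>i. i < l \<Longrightarrow> norm (L (Suc i) (V (L i v))) \<le> \<mu> * norm (L i v)"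
  shows "(\<Sum>k\<le>l. \<kappa> ^ k * (norm (L k (V v)))\<^sup>2)
    \<le> (1 + (\<kappa> - 1) / sqrt \<kappa> * \<mu>)\<^sup>2 * (\<Sum>k\<le>l. \<kappa> ^ k * (norm (L k v))\<^sup>2)"
proof -
  define D where "D k = L k (V (L k v))" for k
  define P where "P k = L (Suc k) (V (L k v))" for k
  define Q where "Q k = L k (V (L (Suc k) v))" for k
  define x where "x k = inner (P k) (D (Suc k))" for k
  have L0: "L i 0 = 0" for i using linL by (rule linear_0)
  have V0: "V 0 = 0" using linV by (rule linear_0)
  have orth: "inner (L i u) (L j w) = (if i = j then inner u (L i w) else 0)" for i j u w
    by (simp add: selfadj LL)
  have orth': "i \<noteq> j \<Longrightarrow> inner (L i u) (L j w) = 0" for i j u w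
    by (simp add: orth)
  \<comment> \<open>By the ladder condition, the image of a single level has at most three nonzero
    components. The index set may run beyond \<open>l\<close>, where the components are zero. Level
    0 has no lower neighbour and is treated separately throughout.\<close>
  have level: "V w = (\<Sum>i\<in>I. L i (V w))"
    if "\<And>i. i \<notin> I \<Longrightarrow> L i (V w) = 0" "finite I" for I w
  proof -
    have "V w = (\<Sum>i\<le>l. L i (V w))" by (simp add: complete)
    also have "\<dots> = (\<Sum>i\<in>{..l} \<union> I. L i (V w))"
      using that beyond by (intro sum.mono_neutral_left) auto
    also have "\<dots> = (\<Sum>i\<in>I. L i (V w))"
      using that by (intro sum.mono_neutral_right) auto
    finally show ?thesis .
  qed
  have V_zero: "V (L 0 v) = D 0 + P 0"
    by (subst level[of "{0, 1}"]) (auto intro!: ladder simp: D_def P_def)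
  have V_Suc: "V (L (Suc k) v) = Q k + D (Suc k) + P (Suc k)" for k
    by (subst level[of "{k, Suc k, Suc (Suc k)}"])
      (auto intro!: ladder simp: D_def P_def Q_def add.assoc)
  have LV: "L k (V v) = (\<Sum>j\<in>J. L k (V (L j v)))"
    if "\<And>j. j \<notin> J \<Longrightarrow> L k (V (L j v)) = 0" "finite J" for k J
  proof -
    have "L k (V v) = L k (V (\<Sum>j\<le>l. L j v))" by (simp add: complete)
    also have "\<dots> = (\<Sum>j\<le>l. L k (V (L j v)))"
      by (simp add: linear_sum[OF linV] linear_sum[OF linL])
    also have "\<dots> = (\<Sum>j\<in>{..l} \<union> J. L k (V (L j v)))"
      using that beyond by (intro sum.mono_neutral_left) (auto simp: V0 L0)
    also have "\<dots> = (\<Sum>j\<in>J. L k (V (L j v)))"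
      using that by (intro sum.mono_neutral_right) auto
    finally show ?thesis .
  qed
  have LV_zero: "L 0 (V v) = D 0 + Q 0"
    by (subst LV[of "{0, 1}"]) (auto intro!: ladder simp: D_def Q_def)
  have LV_Suc: "L (Suc k) (V v) = P k + D (Suc k) + Q (Suc k)" for k
    by (subst LV[of "{k, Suc k, Suc (Suc k)}"])
      (auto intro!: ladder simp: D_def P_def Q_def add.assoc)
  have nsq: "(norm u)\<^sup>2 = inner u u" for u :: 'a by (simp add: power2_norm_eq_inner)
  have isoL: "inner (V (L i v)) (V (L j v)) = (if i = j then (norm (L i v))\<^sup>2 else 0)" for i j
    by (simp add: iso orth nsq LL flip: selfadj)
  have a_zero: "(norm (L 0 v))\<^sup>2 = (norm (D 0))\<^sup>2 + (norm (P 0))\<^sup>2"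
    using isoL[of 0 0] unfolding V_zero
    by (simp add: nsq inner_add_left inner_add_right) (simp add: D_def P_def orth')
  have a_Suc: "(norm (L (Suc k) v))\<^sup>2
      = (norm (Q k))\<^sup>2 + (norm (D (Suc k)))\<^sup>2 + (norm (P (Suc k)))\<^sup>2" for k
    using isoL[of "Suc k" "Suc k"] unfolding V_Suc
    by (simp add: nsq inner_add_left inner_add_right) (simp add: D_def P_def Q_def orth')
  \<comment> \<open>The images of levels \<open>k\<close> and \<open>k + 1\<close> overlap only on
    these two levels. Their orthogonality thus leaves just two inner products, which sum to
    zero.\<close>
  have DQ: "inner (D k) (Q k) = - x k" for k
  proof (cases k)
    case 0
    have "inner (D 0 + P 0) (Q 0 + D (Suc 0) + P (Suc 0)) = 0"
      using isoL[of 0 "Suc 0"] unfolding V_zero V_Suc by simp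
    then show ?thesis unfolding 0 x_def
      by (simp add: inner_add_left inner_add_right) (simp add: D_def P_def Q_def orth')
  next
    case (Suc n)
    have "inner (Q n + D k + P k) (Q k + D (Suc k) + P (Suc k)) = 0"
      using isoL[of k "Suc k"] unfolding Suc V_Suc by simp
    then show ?thesis unfolding x_def Suc
      by (simp add: inner_add_left inner_add_right) (simp add: D_def P_def Q_def orth')
  qed
  \<comment> \<open>The images of levels \<open>k\<close> and \<open>k + 2\<close> meet only on
    level \<open>k + 1\<close>, so orthogonality removes this cross term from the norm of
    \<open>L (Suc k) (V v)\<close>.\<close>
  have PQ: "inner (P k) (Q (Suc k)) = 0" for k
  proof (cases k)
    case 0
    have "inner (D 0 + P 0) (Q (Suc 0) + D (Suc (Suc 0)) + P (Suc (Suc 0))) = 0"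
      using isoL[of 0 "Suc (Suc 0)"] unfolding V_zero V_Suc by simp
    then show ?thesis unfolding 0
      by (simp add: inner_add_left inner_add_right) (simp add: D_def P_def Q_def orth')
  next
    case (Suc n)
    have "inner (Q n + D k + P k) (Q (Suc k) + D (Suc (Suc k)) + P (Suc (Suc k))) = 0"
      using isoL[of k "Suc (Suc k)"] unfolding Suc V_Suc by simp
    then show ?thesis unfolding Suc
      by (simp add: inner_add_left inner_add_right) (simp add: D_def P_def Q_def orth')
  qed
  \<comment> \<open>\<open>?e k\<close> is the net squared norm that \<open>V\<close> carries from
    level \<open>k\<close> up to level \<open>k + 1\<close>: the mass of a level changes by the flow
    from below minus the flow upwards.\<close>
  let ?e = "\<lambda>k. (norm (P k))\<^sup>2 - (norm (Q k))\<^sup>2 + 2 * x k"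
  have lev0: "(norm (L 0 (V v)))\<^sup>2 = (norm (D 0))\<^sup>2 + (norm (Q 0))\<^sup>2 - 2 * x 0"
    unfolding LV_zero using DQ[of 0]
    by (simp add: nsq inner_add_left inner_add_right inner_commute)
  have levS: "(norm (L (Suc k) (V v)))\<^sup>2 = (norm (P k))\<^sup>2 + (norm (D (Suc k)))\<^sup>2
      + (norm (Q (Suc k)))\<^sup>2 + 2 * x k - 2 * x (Suc k)" for k
    unfolding LV_Suc using DQ[of "Suc k"] PQ[of k] x_def[of k]
    by (simp add: nsq inner_add_left inner_add_right inner_commute)
  \<comment> \<open>Summation by parts: a flow across the edge above level \<open>k\<close> gains
    the difference of the weights of levels \<open>k + 1\<close> and \<open>k\<close>. The last term
    is the flow out of level \<open>n\<close>, which vanishes for \<open>n = l\<close>.\<close>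
  have partial: "(\<Sum>k\<le>n. \<kappa> ^ k * (norm (L k (V v)))\<^sup>2)
      = (\<Sum>k\<le>n. \<kappa> ^ k * (norm (L k v))\<^sup>2) + (\<Sum>k<n. \<kappa> ^ k * (\<kappa> - 1) * ?e k) - \<kappa> ^ n * ?e n" for n
  proof (induction n)
    case 0
    show ?case by (simp add: lev0 a_zero)
  next
    case (Suc n)
    then show ?case by (simp add: levS a_Suc) (simp add: algebra_simps)
  qed
  have "P l = 0" "Q l = 0" by (simp_all add: P_def Q_def beyond V0 L0)
  then have "?e l = 0" by (simp add: x_def)
  then have total: "(\<Sum>k\<le>l. \<kappa> ^ k * (norm (L k (V v)))\<^sup>2)
      = (\<Sum>k\<le>l. \<kappa> ^ k * (norm (L k v))\<^sup>2) + (\<Sum>k<l. \<kappa> ^ k * (\<kappa> - 1) * ?e k)"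
    using partial[of l] by simp
  \<comment> \<open>Truncation at 1 meets the requirement of \<open>off_diagonal_bound\<close>. It
    loses nothing, because \<open>V\<close> is an isometry and the upward block never increases the
    norm.\<close>
  define m where "m = min 1 \<mu>"
  \<comment> \<open>The AM-GM weight sqrt(\<open>\<kappa>\<close>) balances the cross term: measured
    in the weighted masses \<open>A k\<close> and \<open>A (Suc k)\<close>, both get the coefficient
    \<open>m / s\<close>.\<close>
  define s where "s = sqrt \<kappa>"
  have m: "0 \<le> m" "m \<le> 1" "m \<le> \<mu>" using mu by (auto simp: m_def)
  have s: "1 < s" "s * s = \<kappa>" using kappa by (auto simp: s_def)
  define A where "A k = \<kappa> ^ k * (norm (L k v))\<^sup>2" for k
  have A0: "A k \<ge> 0" for k using kappa by (simp add: A_def)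
  have le_a: "norm (P k) \<le> norm (L k v)" "norm (D k) \<le> norm (L k v)" for k
  proof -
    have "(norm (P k))\<^sup>2 \<le> (norm (L k v))\<^sup>2 \<and> (norm (D k))\<^sup>2 \<le> (norm (L k v))\<^sup>2"
      by (cases k) (simp_all add: a_zero a_Suc)
    then show "norm (P k) \<le> norm (L k v)" "norm (D k) \<le> norm (L k v)"
      by (auto intro: power2_le_imp_le)
  qed
  have e_le: "\<kappa> ^ k * (\<kappa> - 1) * ?e k
      \<le> (\<kappa> - 1) * (m\<^sup>2 + m / s) * A k + (\<kappa> - 1) * (m / s - m\<^sup>2 / \<kappa>) * A (Suc k)" if "k < l" for k
  proof -
    let ?a = "norm (L k v)" and ?b = "norm (L (Suc k) v)"
    have p: "norm (P k) \<le> m * ?a"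
      using up[OF that] le_a(1)[of k] by (auto simp: m_def min_def P_def)
    have "x k \<le> norm (P k) * norm (D (Suc k))" unfolding x_def by (rule norm_cauchy_schwarz)
    also have "\<dots> \<le> (m * ?a) * ?b" by (intro mult_mono p le_a) (simp_all add: m)
    finally have x1: "x k \<le> m * ?a * ?b" .
    have "x k = inner (- D k) (Q k)" using DQ[of k] by simp
    also have "\<dots> \<le> norm (D k) * norm (Q k)" by (metis norm_cauchy_schwarz norm_minus_cancel)
    also have "\<dots> \<le> ?a * norm (Q k)" by (intro mult_right_mono le_a) simp
    finally have x2: "x k \<le> ?a * norm (Q k)" .
    have "2 * x k - (norm (Q k))\<^sup>2 \<le> m * (?a\<^sup>2 / s + s * ?b\<^sup>2) - m\<^sup>2 * ?b\<^sup>2"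
      using m s x1 x2 by (intro off_diagonal_bound) auto
    moreover have "(norm (P k))\<^sup>2 \<le> m\<^sup>2 * ?a\<^sup>2"
      using power_mono[OF p, of 2] by (simp add: power_mult_distrib)
    ultimately have "?e k \<le> m\<^sup>2 * ?a\<^sup>2 + m * (?a\<^sup>2 / s + s * ?b\<^sup>2) - m\<^sup>2 * ?b\<^sup>2" by linarith
    then have "\<kappa> ^ k * (\<kappa> - 1) * ?e k
        \<le> \<kappa> ^ k * (\<kappa> - 1) * (m\<^sup>2 * ?a\<^sup>2 + m * (?a\<^sup>2 / s + s * ?b\<^sup>2) - m\<^sup>2 * ?b\<^sup>2)"
      using kappa by (intro mult_left_mono) auto
    also have "\<dots> = (\<kappa> - 1) * (m\<^sup>2 + m / s) * A k + (\<kappa> - 1) * (m / s - m\<^sup>2 / \<kappa>) * A (Suc k)"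
      using s unfolding A_def by (simp add: field_simps flip: s(2))
    finally show ?thesis .
  qed
  \<comment> \<open>The coefficient of \<open>A (Suc k)\<close> is therefore nonnegative, and both
    sums may be enlarged to the sum over all levels.\<close>
  have h: "m\<^sup>2 / \<kappa> \<le> m / s"
  proof -
    have "m\<^sup>2 / \<kappa> = (m / s) * (m / s)" using s(2) by (simp add: power2_eq_square)
    also have "\<dots> \<le> (m / s) * 1" using m s by (intro mult_left_mono) auto
    finally show ?thesis by simp
  qed
  have "(\<Sum>k<l. \<kappa> ^ k * (\<kappa> - 1) * ?e k)
      \<le> (\<Sum>k<l. (\<kappa> - 1) * (m\<^sup>2 + m / s) * A k + (\<kappa> - 1) * (m / s - m\<^sup>2 / \<kappa>) * A (Suc k))"
    by (intro sum_mono) (use e_le in auto)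
  also have "\<dots> = (\<kappa> - 1) * (m\<^sup>2 + m / s) * (\<Sum>k<l. A k)
      + (\<kappa> - 1) * (m / s - m\<^sup>2 / \<kappa>) * (\<Sum>k<l. A (Suc k))"
    by (simp only: sum.distrib sum_distrib_left)
  also have "\<dots> \<le> (\<kappa> - 1) * (m\<^sup>2 + m / s) * (\<Sum>k\<le>l. A k)
      + (\<kappa> - 1) * (m / s - m\<^sup>2 / \<kappa>) * (\<Sum>k\<le>l. A k)"
  proof (intro add_mono mult_left_mono)
    show "(\<Sum>k<l. A k) \<le> (\<Sum>k\<le>l. A k)" by (intro sum_mono2) (auto simp: A0)
    show "(\<Sum>k<l. A (Suc k)) \<le> (\<Sum>k\<le>l. A k)"
      by (simp add: sum.atMost_shift A0)
  qed (use kappa m s h in auto)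
  \<comment> \<open>The two coefficients add up to \<open>(\<kappa> - 1) * (2 * m / s + m\<^sup>2 *
    (1 - 1 / \<kappa>))\<close>, which completes the square because
    \<open>s * s = \<kappa>\<close>.\<close>
  also have "\<dots> = ((1 + (\<kappa> - 1) / s * m)\<^sup>2 - 1) * (\<Sum>k\<le>l. A k)"
    using s by (simp add: field_simps power2_eq_square flip: s(2))
  finally have "(\<Sum>k\<le>l. \<kappa> ^ k * (norm (L k (V v)))\<^sup>2)
      \<le> (1 + (\<kappa> - 1) / s * m)\<^sup>2 * (\<Sum>k\<le>l. A k)"
    unfolding total by (simp add: A_def algebra_simps)
  also have "\<dots> \<le> (1 + (\<kappa> - 1) / s * \<mu>)\<^sup>2 * (\<Sum>k\<le>l. A k)"
    using kappa m s A0
    by (intro mult_right_mono power_mono add_left_mono mult_left_mono sum_nonneg) auto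
  finally show ?thesis by (simp add: A_def s_def)
qed

subsection \<open>Orthogonal projectors and adversary matrices\<close>

lemma inner_eq_Re_cinner: "inner u v = Re (cinner u v)"
  by (simp add: inner_vec_def cinner_def inner_complex_def)

lemma cinner_add_right: "cinner u (v + w) = cinner u v + cinner u w"
  by (simp add: cinner_def algebra_simps sum.distrib)

lemma cinner_diff_right: "cinner u (v - w) = cinner u v - cinner u w"
  by (simp add: cinner_def algebra_simps sum_subtractf)

lemma cinner_scale_right: "cinner u (c *s v) = c * cinner u v"
  by (simp add: cinner_def algebra_simps sum_distrib_left)

lemma cinner_scale_left: "cinner (c *s u) v = cnj c * cinner u v"
  by (simp add: cinner_def algebra_simps sum_distrib_left)

lemma cinner_zero_right [simp]: "cinner u 0 = 0"
  by (simp add: cinner_def)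

lemma cinner_zero_left [simp]: "cinner 0 v = 0"
  by (simp add: cinner_def)

lemma cinner_sum_right: "cinner u (\<Sum>i\<in>I. v i) = (\<Sum>i\<in>I. cinner u (v i))"
  by (induction I rule: infinite_finite_induct) (auto simp: cinner_add_right)

lemma cinner_commute: "cinner u v = cnj (cinner v u)"
  by (simp add: cinner_def mult.commute)

lemma cinner_self: "cinner v v = of_real ((norm v)\<^sup>2)"
proof (rule complex_eqI)
  show "Re (cinner v v) = Re (of_real ((norm v)\<^sup>2))"
    by (simp add: power2_norm_eq_inner inner_eq_Re_cinner)
  show "Im (cinner v v) = Im (of_real ((norm v)\<^sup>2))"
    by (simp add: cinner_def algebra_simps)
qed

lemma cinner_self_eq_0_iff: "cinner v v = 0 \<longleftrightarrow> v = 0"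
  by (simp add: cinner_self)

lemma cinner_adjoint: "cinner (A *v u) v = cinner u (cadjoint A *v v)"
proof -
  have "cinner (A *v u) v = (\<Sum>i\<in>UNIV. \<Sum>j\<in>UNIV. cnj (u $ j) * (cnj (A $ i $ j) * v $ i))"
    by (simp add: cinner_def matrix_vector_mult_def sum_distrib_left mult_ac)
  also have "\<dots> = (\<Sum>j\<in>UNIV. \<Sum>i\<in>UNIV. cnj (u $ j) * (cnj (A $ i $ j) * v $ i))"
    by (rule sum.swap)
  also have "\<dots> = cinner u (cadjoint A *v v)"
    by (simp add: cinner_def cadjoint_def matrix_vector_mult_def sum_distrib_left)
  finally show ?thesis .
qed

lemma isometry_cinner:
  assumes "cadjoint U ** U = mat 1"
  shows "cinner (U *v u) (U *v v) = cinner u v"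
  by (simp add: cinner_adjoint matrix_vector_mul_assoc assms)

lemma isometry_norm:
  assumes "cadjoint U ** U = mat 1"
  shows "norm (U *v v) = norm v"
  by (simp add: norm_eq_sqrt_inner inner_eq_Re_cinner isometry_cinner assms)

lemma scaleR_eq_scale: "r *\<^sub>R v = complex_of_real r *s (v :: complex ^ 'n)"
  by (simp add: vec_eq_iff) (simp add: scaleR_conv_of_real)

lemma norm_scale: "norm (c *s v) = cmod c * norm (v :: complex ^ 'n)"
  by (simp add: norm_vec_def L2_set_def norm_mult power_mult_distrib real_sqrt_mult
      flip: sum_distrib_left)

lemma norm_vec_square: "(norm (v :: complex ^ 'n))\<^sup>2 = (\<Sum>i\<in>UNIV. (cmod (v $ i))\<^sup>2)"
  by (simp add: power2_norm_eq_inner inner_vec_def)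

lemma matrix_vector_mult_sum_right: "A *v (\<Sum>i\<in>I. v i) = (\<Sum>i\<in>I. A *v v i)"
  for A :: "complex ^ 'n ^ 'm"
  by (induction I rule: infinite_finite_induct) (auto simp: algebra_simps)

lemma matrix_vector_mult_sum_left: "(\<Sum>i\<in>I. A i) *v v = (\<Sum>i\<in>I. A i *v v)"
  for A :: "'i \<Rightarrow> complex ^ 'n ^ 'm"
  by (induction I rule: infinite_finite_induct) (auto simp: algebra_simps)

lemma scaleR_matrix_vector: "(r *\<^sub>R A) *v v = r *\<^sub>R (A *v v)" for A :: "complex ^ 'n ^ 'm"
  by (simp add: vec_eq_iff matrix_vector_mult_def scaleR_sum_right)

lemma opnorm_bound: "norm (A *v v) \<le> opnorm A * norm v"
  unfolding opnorm_def by (intro onorm matrix_vector_mul_bounded_linear)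

lemma opnorm_nonneg: "0 \<le> opnorm A"
  unfolding opnorm_def by (intro onorm_pos_le matrix_vector_mul_bounded_linear)


section \<open>Orthogonal projectors onto complex subspaces\<close>

lemma orth_proj_unique_vec:
  assumes "vec.subspace S" "y \<in> S" "y' \<in> S"
    "\<And>u. u \<in> S \<Longrightarrow> cinner u (v - y) = 0" "\<And>u. u \<in> S \<Longrightarrow> cinner u (v - y') = 0"
  shows "y = y'"
proof -
  \<comment> \<open>The difference of two candidates lies in \<open>S\<close> and is orthogonal to
    \<open>S\<close>, hence to itself.\<close>
  have "y - y' \<in> S" using assms by (intro vec.subspace_diff)
  then have "cinner (y - y') (v - y') - cinner (y - y') (v - y) = 0" using assms by simp
  then have "cinner (y - y') (y - y') = 0" by (simp add: cinner_diff_right[symmetric])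
  then show ?thesis by (simp add: cinner_self_eq_0_iff)
qed

text \<open>A complex subspace is closed under multiplication by \<open>\<i>\<close>, so vectors that are orthogonal to
  it for the real inner product are orthogonal for the complex one.\<close>

lemma is_orth_proj_orth_proj:
  assumes S: "vec.subspace S"
  shows "is_orth_proj S (orth_proj S)"
proof -
  have "subspace S"
    unfolding subspace_def scaleR_eq_scale
    using S by (auto intro: vec.subspace_0 vec.subspace_add vec.subspace_scale)
  then have span: "span S = S" by (simp add: span_eq_iff)
  have ex: "\<exists>y. y \<in> S \<and> (\<forall>u\<in>S. cinner u (v - y) = 0)" for v
  proof -
    obtain y z where y: "y \<in> span S" and z: "\<And>w. w \<in> span S \<Longrightarrow> orthogonal z w" and v: "v = y + z"
      using orthogonal_subspace_decomp_exists[of S v] by blast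
    have "cinner u z = 0" if u: "u \<in> S" for u
    proof (rule complex_eqI)
      show "Re (cinner u z) = Re 0"
        using z[of u] u unfolding span by (simp add: orthogonal_def inner_commute inner_eq_Re_cinner[symmetric])
      have "Re (cinner (\<i> *s u) z) = 0"
        using z[of "\<i> *s u"] vec.subspace_scale[OF S u, of \<i>] unfolding span
        by (simp add: orthogonal_def inner_commute inner_eq_Re_cinner[symmetric])
      then show "Im (cinner u z) = Im 0" by (simp add: cinner_scale_left)
    qed
    moreover have "v - y = z" using v by simp
    ultimately show ?thesis using y unfolding span by blast
  qed
  then obtain p where p: "\<And>v. p v \<in> S" "\<And>u v. u \<in> S \<Longrightarrow> cinner u (v - p v) = 0" by metis
  \<comment> \<open>The pointwise choice \<open>p\<close> is linear because projections are unique,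
    so it is given by a matrix.\<close>
  have "p (v + w) = p v + p w" for v w
  proof (rule orth_proj_unique_vec[OF S, of _ _ "v + w"])
    fix u assume "u \<in> S"
    then have "cinner u ((v - p v) + (w - p w)) = 0" using p by (simp add: cinner_add_right)
    then show "cinner u (v + w - (p v + p w)) = 0" by (simp add: algebra_simps)
  qed (use p S in \<open>auto intro: vec.subspace_add\<close>)
  moreover have "p (c *s v) = c *s p v" for c v
  proof (rule orth_proj_unique_vec[OF S, of _ _ "c *s v"])
    fix u assume "u \<in> S"
    then have "cinner u (c *s (v - p v)) = 0" using p(2)[of u v] by (simp only: cinner_scale_right mult_zero_right)
    then show "cinner u (c *s v - c *s p v) = 0" by (simp only: vector_ssub_ldistrib)
  qed (use p S in \<open>auto intro: vec.subspace_scale\<close>)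
  ultimately have "Vector_Spaces.linear (*s) (*s) p"
    by unfold_locales
  then have "matrix p *v v = p v" for v by (rule matrix_works)
  then have P: "is_orth_proj S (matrix p)" using p by (simp add: is_orth_proj_def)
  moreover have "P' = matrix p" if "is_orth_proj S P'" for P'
    unfolding matrix_eq using orth_proj_unique_vec[OF S] P that
    unfolding is_orth_proj_def by blast
  ultimately show ?thesis unfolding orth_proj_def by (rule theI)
qed

lemma orth_proj_eqI:
  assumes S: "vec.subspace S" and P: "is_orth_proj S P"
  shows "orth_proj S = P"
proof -
  have "orth_proj S *v v = P *v v" for v
    by (rule orth_proj_unique_vec[OF S, of _ _ v])
      (use P is_orth_proj_orth_proj[OF S] in \<open>auto simp: is_orth_proj_def\<close>)
  then show ?thesis by (simp add: matrix_eq)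
qed

context
  fixes S :: "(complex ^ 'n) set"
  assumes S: "vec.subspace S"
begin

lemma orth_proj_in: "orth_proj S *v v \<in> S"
  using is_orth_proj_orth_proj[OF S] by (simp add: is_orth_proj_def)

lemma orth_proj_orth: "u \<in> S \<Longrightarrow> cinner u (v - orth_proj S *v v) = 0"
  using is_orth_proj_orth_proj[OF S] by (simp add: is_orth_proj_def)

lemma orth_proj_fixed: "v \<in> S \<Longrightarrow> orth_proj S *v v = v"
  by (rule orth_proj_unique_vec[OF S, of _ _ v]) (auto intro: orth_proj_in orth_proj_orth)

lemma orth_proj_cinner: "u \<in> S \<Longrightarrow> cinner u (orth_proj S *v v) = cinner u v"
  using orth_proj_orth[of u v] by (simp add: cinner_diff_right)

lemma orth_proj_selfadjoint: "cinner (orth_proj S *v u) v = cinner u (orth_proj S *v v)"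
  using orth_proj_cinner[OF orth_proj_in, of u v] orth_proj_cinner[OF orth_proj_in, of v u]
  by (metis cinner_commute)

end

lemma subspace_eigenspace: "vec.subspace (eigenspace A c)"
proof (rule vec.subspaceI)
  fix a v assume "v \<in> eigenspace A c"
  then have "A *v (a *s v) = a *s (c *s v)" by (simp add: eigenspace_def vector_scalar_commute)
  then show "a *s v \<in> eigenspace A c" by (simp add: eigenspace_def mult.commute)
qed (auto simp: eigenspace_def matrix_vector_right_distrib vec.scale_right_distrib)

lemma subspace_reach_space: "vec.subspace (reach_space ev \<delta> t)"
  by (simp add: reach_space_def vec.subspace_span)

section \<open>Spectral calculus of an MLA matrix\<close>

locale mla =
  fixes ev :: "'f::finite \<Rightarrow> 'x::finite \<Rightarrow> 'm::finite mod_ring"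
    and \<delta> :: "'f pmf" and \<kappa> :: real and l :: nat
    and \<Lambda> :: "nat \<Rightarrow> complex ^ 'f ^ 'f" and \<Gamma> :: "complex ^ 'f ^ 'f"
  assumes mla_matrix: "mla_matrix ev \<delta> \<kappa> l \<Lambda> \<Gamma>"
begin

definition E :: "nat \<Rightarrow> (complex ^ 'f) set" where
  "E i = eigenspace \<Gamma> (of_real (\<kappa> ^ i))"

lemma subspace_E: "vec.subspace (E i)"
  by (simp only: E_def subspace_eigenspace)

lemma mem_E: "v \<in> E i \<longleftrightarrow> \<Gamma> *v v = of_real (\<kappa> ^ i) *s v"
  by (simp add: E_def eigenspace_def)

lemma kappa_gt_1: "\<kappa> > 1"
  using mla_matrix unfolding mla_matrix_def by blast

lemma eigenvalues_Gamma: "eigenvalues \<Gamma> = {of_real (\<kappa> ^ i) |i. i \<le> l}"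
  using mla_matrix unfolding mla_matrix_def by blast

lemma Lambda_eq: "i \<le> l \<Longrightarrow> \<Lambda> i = orth_proj (E i)"
  using mla_matrix unfolding mla_matrix_def E_def by blast

lemma Gamma_eq: "\<Gamma> *v v = (\<Sum>i\<le>l. \<kappa> ^ i *\<^sub>R (\<Lambda> i *v v))"
proof -
  have "\<Gamma> = (\<Sum>i\<le>l. \<kappa> ^ i *\<^sub>R \<Lambda> i)" using mla_matrix unfolding mla_matrix_def by blast
  then show ?thesis
    by (simp add: matrix_vector_mult_sum_left scaleR_matrix_vector)
qed

lemma Gamma_selfadjoint: "cinner (\<Gamma> *v u) v = cinner u (\<Gamma> *v v)"
proof -
  have "cadjoint \<Gamma> = \<Gamma>" using mla_matrix unfolding mla_matrix_def pos_def_def by blast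
  then show ?thesis by (simp add: cinner_adjoint)
qed

lemma Gamma_injective: "\<Gamma> *v v = 0 \<Longrightarrow> v = 0"
proof -
  have "\<forall>v. v \<noteq> 0 \<longrightarrow> 0 < cinner v (\<Gamma> *v v)"
    using mla_matrix unfolding mla_matrix_def pos_def_def by blast
  then show "\<Gamma> *v v = 0 \<Longrightarrow> v = 0" by fastforce
qed

lemma Lambda_in: "i \<le> l \<Longrightarrow> \<Lambda> i *v v \<in> E i"
  by (simp only: Lambda_eq orth_proj_in subspace_E)

lemma Lambda_fixed: "i \<le> l \<Longrightarrow> v \<in> E i \<Longrightarrow> \<Lambda> i *v v = v"
  by (simp add: Lambda_eq orth_proj_fixed subspace_E)

lemma Lambda_selfadjoint: "i \<le> l \<Longrightarrow> cinner (\<Lambda> i *v u) v = cinner u (\<Lambda> i *v v)"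
  by (simp add: Lambda_eq orth_proj_selfadjoint subspace_E)

lemma eigenspaces_orthogonal:
  assumes "u \<in> E i" "v \<in> E j" "i \<noteq> j"
  shows "cinner u v = 0"
proof -
  have "of_real (\<kappa> ^ i) * cinner u v = of_real (\<kappa> ^ j) * cinner u v"
    using Gamma_selfadjoint[of u v] assms
    by (simp add: mem_E cinner_scale_left cinner_scale_right)
  moreover have "\<kappa> ^ i \<noteq> \<kappa> ^ j" using kappa_gt_1 assms(3) by simp
  ultimately show ?thesis by (metis mult_cancel_right of_real_eq_iff)
qed

lemma Lambda_Lambda:
  assumes "i \<le> l" "j \<le> l"
  shows "\<Lambda> i *v (\<Lambda> j *v v) = (if i = j then \<Lambda> i *v v else 0)"
proof (cases "i = j")
  case True
  then show ?thesis using assms by (simp add: Lambda_fixed Lambda_in)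
next
  case False
  let ?w = "\<Lambda> i *v (\<Lambda> j *v v)"
  have "cinner ?w ?w = cinner ?w (\<Lambda> j *v v)"
    using assms by (metis Lambda_selfadjoint Lambda_fixed Lambda_in)
  also have "\<dots> = 0" using assms False by (auto intro!: eigenspaces_orthogonal[of _ i _ j] simp: Lambda_in)
  finally show ?thesis using False by (simp add: cinner_self_eq_0_iff)
qed

text \<open>Every \<open>\<Lambda> j\<close> kills the remainder, so the spectral sum for
  \<open>\<Gamma>\<close> kills it too, and a positive definite matrix is injective.\<close>

lemma Lambda_complete: "(\<Sum>i\<le>l. \<Lambda> i *v v) = v"
proof -
  let ?w = "v - (\<Sum>i\<le>l. \<Lambda> i *v v)"
  have "\<Lambda> j *v ?w = 0" if "j \<le> l" for j
    using that by (simp add: matrix_vector_mult_diff_distrib matrix_vector_mult_sum_right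
        Lambda_Lambda sum.delta)
  then have "\<Gamma> *v ?w = 0" unfolding Gamma_eq by simp
  then show ?thesis using Gamma_injective by fastforce
qed

lemma cinner_Lambda: "i \<le> l \<Longrightarrow> cinner v (\<Lambda> i *v v) = of_real ((norm (\<Lambda> i *v v))\<^sup>2)"
  by (metis Lambda_selfadjoint Lambda_fixed Lambda_in cinner_self)

lemma cinner_Gamma: "cinner v (\<Gamma> *v v) = of_real (\<Sum>i\<le>l. \<kappa> ^ i * (norm (\<Lambda> i *v v))\<^sup>2)"
  by (simp add: Gamma_eq cinner_sum_right scaleR_eq_scale cinner_scale_right cinner_Lambda)

lemma norm_Lambda: "(norm v)\<^sup>2 = (\<Sum>i\<le>l. (norm (\<Lambda> i *v v))\<^sup>2)"
proof -
  have "cinner v v = (\<Sum>i\<le>l. cinner v (\<Lambda> i *v v))"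
    by (simp add: Lambda_complete flip: cinner_sum_right)
  then have "of_real ((norm v)\<^sup>2) = (of_real (\<Sum>i\<le>l. (norm (\<Lambda> i *v v))\<^sup>2) :: complex)"
    by (simp add: cinner_self cinner_Lambda)
  then show ?thesis using of_real_eq_iff by blast
qed

text \<open>The spaces are constant from \<open>CARD('x)\<close> on. This extends the commutation
  with \<open>\<Gamma>\<close>, assumed only up to that index, to every \<open>t\<close>.\<close>

lemma reach_space_min: "reach_space ev \<delta> t = reach_space ev \<delta> (min t CARD('x))"
proof -
  have "min t CARD('x) = 0 \<longleftrightarrow> t = 0" by (auto simp: min_def)
  then show ?thesis by (simp only: reach_space_def min.right_idem)
qed

lemma Gamma_reach_proj: "\<Gamma> *v (reach_proj ev \<delta> t *v v) = reach_proj ev \<delta> t *v (\<Gamma> *v v)"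
proof -
  have "\<forall>t\<le>CARD('x). \<Gamma> ** reach_proj ev \<delta> t = reach_proj ev \<delta> t ** \<Gamma>"
    using mla_matrix unfolding mla_matrix_def by blast
  then have "\<Gamma> ** reach_proj ev \<delta> (min t CARD('x)) = reach_proj ev \<delta> (min t CARD('x)) ** \<Gamma>"
    by simp
  then show ?thesis
    unfolding reach_proj_def reach_space_min[of t] by (simp add: matrix_vector_mul_assoc)
qed

text \<open>A matrix commuting with \<open>\<Gamma>\<close> maps each eigenspace into itself, and
  therefore commutes with the projectors onto the eigenspaces.\<close>

lemma Lambda_reach_proj:
  assumes i: "i \<le> l"
  shows "\<Lambda> i *v (reach_proj ev \<delta> t *v v) = reach_proj ev \<delta> t *v (\<Lambda> i *v v)"
proof -
  let ?P = "reach_proj ev \<delta> t"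
  have inE: "?P *v (\<Lambda> j *v v) \<in> E j" if "j \<le> l" for j
    using Lambda_in[OF that, of v] by (simp add: mem_E Gamma_reach_proj vector_scalar_commute)
  have "\<Lambda> i *v (?P *v v) = \<Lambda> i *v (?P *v (\<Sum>j\<le>l. \<Lambda> j *v v))" by (simp add: Lambda_complete)
  also have "\<dots> = (\<Sum>j\<le>l. \<Lambda> i *v (?P *v (\<Lambda> j *v v)))" by (simp add: matrix_vector_mult_sum_right)
  also have "\<dots> = (\<Sum>j\<le>l. if i = j then ?P *v (\<Lambda> j *v v) else 0)"
  proof (intro sum.cong refl)
    fix j assume "j \<in> {..l}"
    then have j: "j \<le> l" by simp
    have fixed: "\<Lambda> j *v (?P *v (\<Lambda> j *v v)) = ?P *v (\<Lambda> j *v v)"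
      using j by (simp add: Lambda_fixed inE)
    show "\<Lambda> i *v (?P *v (\<Lambda> j *v v)) = (if i = j then ?P *v (\<Lambda> j *v v) else 0)"
      using Lambda_Lambda[OF i j, of "?P *v (\<Lambda> j *v v)"] unfolding fixed by (auto simp: fixed)
  qed
  also have "\<dots> = ?P *v (\<Lambda> i *v v)" using i by (simp add: sum.delta)
  finally show ?thesis .
qed

lemma Lambda_reach_space:
  assumes "i \<le> l" "v \<in> reach_space ev \<delta> t"
  shows "\<Lambda> i *v v \<in> reach_space ev \<delta> t"
proof -
  have "\<Lambda> i *v v = reach_proj ev \<delta> t *v (\<Lambda> i *v v)"
    using Lambda_reach_proj[OF assms(1), of t v] assms(2)
    by (simp add: reach_proj_def orth_proj_fixed subspace_reach_space)
  then show ?thesis by (metis reach_proj_def orth_proj_in subspace_reach_space)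
qed

lemma Lambda_phase_oracle_Lambda:
  assumes "i \<le> l" "j \<le> l" "\<bar>int i - int j\<bar> > 1"
  shows "\<Lambda> i *v (phase_oracle ev x y *v (\<Lambda> j *v v)) = 0"
proof -
  have "opnorm (\<Lambda> i ** phase_oracle ev x y ** \<Lambda> j) = 0"
    using assms mla_matrix unfolding mla_matrix_def by blast
  then show ?thesis
    using opnorm_bound[of "\<Lambda> i ** phase_oracle ev x y ** \<Lambda> j" v]
    by (simp add: matrix_vector_mul_assoc matrix_mul_assoc)
qed

lemma bad_proj_eq: "bad_proj \<Gamma> lam *v v = (\<Sum>i\<in>{i. i \<le> l \<and> \<kappa> ^ i < lam}. \<Lambda> i *v v)"
proof -
  let ?I = "{i. i \<le> l \<and> \<kappa> ^ i < lam}"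
  let ?G = "\<Union>c\<in>{c\<in>eigenvalues \<Gamma>. c < of_real lam}. eigenspace \<Gamma> c"
  have G: "?G = (\<Union>i\<in>?I. E i)"
    \<comment> \<open>All eigenvalues are real, so the order on complex numbers compares just the
      powers of \<open>\<kappa>\<close> with \<open>lam\<close>.\<close>
    unfolding eigenvalues_Gamma E_def by (force simp: less_complex_def simp del: of_real_power)
  have "is_orth_proj (vec.span ?G) (\<Sum>i\<in>?I. \<Lambda> i)"
    unfolding is_orth_proj_def matrix_vector_mult_sum_left
  proof (intro allI conjI ballI)
    fix v
    show "(\<Sum>i\<in>?I. \<Lambda> i *v v) \<in> vec.span ?G"
      unfolding G using Lambda_in by (intro vec.span_sum vec.span_base) blast
    fix u assume "u \<in> vec.span ?G"
    \<comment> \<open>The arguments are swapped for the span induction: \<open>cinner\<close> is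
      linear in its second argument but conjugate-linear in the first.\<close>
    then have "cinner (v - (\<Sum>i\<in>?I. \<Lambda> i *v v)) u = 0"
    proof (induction rule: vec.span_induct_alt)
      case (step c x y)
      then obtain j where j: "j \<in> ?I" and x: "x \<in> E j"
        unfolding G by blast
      have "cinner x (\<Lambda> i *v v) = (if i = j then cinner x v else 0)" if "i \<in> ?I" for i
        using that x eigenspaces_orthogonal[OF x Lambda_in] Lambda_selfadjoint[of i x v] Lambda_fixed
        by auto
      then have "cinner x (v - (\<Sum>i\<in>?I. \<Lambda> i *v v)) = 0"
        using j by (simp add: cinner_diff_right cinner_sum_right sum.delta)
      then have "cinner (v - (\<Sum>i\<in>?I. \<Lambda> i *v v)) x = 0" by (metis cinner_commute complex_cnj_zero)
      then show ?case using step by (simp add: cinner_add_right cinner_scale_right)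
    qed simp
    then show "cinner u (v - (\<Sum>i\<in>?I. \<Lambda> i *v v)) = 0" by (metis cinner_commute complex_cnj_zero)
  qed
  then show ?thesis
    unfolding bad_proj_def by (simp add: orth_proj_eqI vec.subspace_span matrix_vector_mult_sum_left)
qed

end

subsection \<open>Registers and the Fourier basis\<close>

definition slice :: "complex ^ ('a::finite \<times> 'b::finite) \<Rightarrow> 'a \<Rightarrow> complex ^ 'b" where
  "slice \<psi> a = (\<chi> b. \<psi> $ (a, b))"

lemma slice_component [simp]: "slice \<psi> a $ b = \<psi> $ (a, b)"
  by (simp add: slice_def)

lemma sum_UNIV_prod: "(\<Sum>p\<in>UNIV. f p) = (\<Sum>a\<in>UNIV. \<Sum>b\<in>UNIV. f (a, b))"
  for f :: "'a::finite \<times> 'b::finite \<Rightarrow> 'c::comm_monoid_add"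
  by (simp add: sum.cartesian_product UNIV_Times_UNIV[symmetric] del: UNIV_Times_UNIV)

lemma norm_slices: "(norm \<psi>)\<^sup>2 = (\<Sum>a\<in>UNIV. (norm (slice \<psi> a))\<^sup>2)"
  by (simp add: norm_vec_square sum_UNIV_prod)

text \<open>The reduced state is the sum of the rank-one operators of the slices, so the trace
  becomes a sum of quadratic forms of \<open>\<Gamma>\<close>.\<close>

lemma trace_partial_trace_fst:
  "trace (\<Gamma> ** partial_trace_fst (ketbra \<psi> \<psi>)) = (\<Sum>a\<in>UNIV. cinner (slice \<psi> a) (\<Gamma> *v slice \<psi> a))"
proof -
  have "trace (\<Gamma> ** partial_trace_fst (ketbra \<psi> \<psi>))
      = (\<Sum>i\<in>UNIV. \<Sum>j\<in>UNIV. \<Sum>a\<in>UNIV. cnj (\<psi> $ (a, i)) * (\<Gamma> $ i $ j * \<psi> $ (a, j)))"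
    by (simp add: trace_def matrix_matrix_mult_def partial_trace_fst_def ketbra_def
        sum_distrib_left mult_ac)
  also have "\<dots> = (\<Sum>i\<in>UNIV. \<Sum>a\<in>UNIV. \<Sum>j\<in>UNIV. cnj (\<psi> $ (a, i)) * (\<Gamma> $ i $ j * \<psi> $ (a, j)))"
    by (intro sum.cong refl sum.swap)
  also have "\<dots> = (\<Sum>a\<in>UNIV. \<Sum>i\<in>UNIV. \<Sum>j\<in>UNIV. cnj (\<psi> $ (a, i)) * (\<Gamma> $ i $ j * \<psi> $ (a, j)))"
    by (rule sum.swap)
  also have "\<dots> = (\<Sum>a\<in>UNIV. cinner (slice \<psi> a) (\<Gamma> *v slice \<psi> a))"
    by (simp add: cinner_def matrix_vector_mult_def sum_distrib_left)
  finally show ?thesis .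
qed

lemma slice_tensor_mat:
  fixes \<psi> :: "complex ^ ('a::finite \<times> 'b::finite)"
  shows "slice (tensor_mat U (mat 1) *v \<psi>) a = (\<Sum>b\<in>UNIV. U $ a $ b *s slice \<psi> b)"
proof -
  have "(\<Sum>f'\<in>UNIV. U $ a $ b * (mat 1 :: complex ^ 'b ^ 'b) $ f $ f' * \<psi> $ (b, f')) = U $ a $ b * \<psi> $ (b, f)" for b f
  proof -
    have "(\<Sum>f'\<in>UNIV. U $ a $ b * (mat 1 :: complex ^ 'b ^ 'b) $ f $ f' * \<psi> $ (b, f'))
        = (\<Sum>f'\<in>UNIV. if f' = f then U $ a $ b * \<psi> $ (b, f') else 0)"
      by (intro sum.cong) (auto simp: mat_def)
    then show ?thesis by simp
  qed
  then show ?thesis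
    by (simp add: vec_eq_iff matrix_vector_mult_def tensor_mat_def sum_UNIV_prod)
qed

lemma slice_tensor_vec: "slice (tensor_vec u v) a = u $ a *s v"
  by (simp add: vec_eq_iff tensor_vec_def)

text \<open>For each coordinate \<open>c\<close>, the isometry acts on the vector of the numbers
  \<open>(B *v \<phi> b) $ c\<close> indexed by \<open>b\<close>. The lemma serves both the
  unitaries of the algorithm and the Fourier transform, with \<open>B\<close> a spectral projector
  or the identity.\<close>

lemma isometry_family:
  fixes B :: "complex ^ 'b ^ 'c" and \<phi> :: "'a::finite \<Rightarrow> complex ^ 'b"
  assumes U: "cadjoint U ** U = mat 1"
  shows "(\<Sum>a\<in>UNIV. (norm (B *v (\<Sum>b\<in>UNIV. U $ a $ b *s \<phi> b)))\<^sup>2) = (\<Sum>b\<in>UNIV. (norm (B *v \<phi> b))\<^sup>2)"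
proof -
  have "(\<Sum>a\<in>UNIV. (cmod (\<Sum>b\<in>UNIV. U $ a $ b * (B *v \<phi> b) $ c))\<^sup>2)
      = (\<Sum>b\<in>UNIV. (cmod ((B *v \<phi> b) $ c))\<^sup>2)" for c
    using arg_cong[OF isometry_norm[OF U, of "\<chi> b. (B *v \<phi> b) $ c"], of "\<lambda>r. r\<^sup>2"]
    by (simp add: norm_vec_square matrix_vector_mult_def)
  then have "(\<Sum>c\<in>UNIV. \<Sum>a\<in>UNIV. (cmod (\<Sum>b\<in>UNIV. U $ a $ b * (B *v \<phi> b) $ c))\<^sup>2)
      = (\<Sum>c\<in>UNIV. \<Sum>b\<in>UNIV. (cmod ((B *v \<phi> b) $ c))\<^sup>2)"
    by simp
  then have "(\<Sum>a\<in>UNIV. \<Sum>c\<in>UNIV. (cmod (\<Sum>b\<in>UNIV. U $ a $ b * (B *v \<phi> b) $ c))\<^sup>2)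
      = (\<Sum>b\<in>UNIV. \<Sum>c\<in>UNIV. (cmod ((B *v \<phi> b) $ c))\<^sup>2)"
    by (subst (1 2) sum.swap)
  then show ?thesis
    by (simp add: matrix_vector_mult_sum_right vector_scalar_commute norm_vec_square)
qed

lemma unitary_slices:
  assumes "unitary U"
  shows "(\<Sum>a\<in>UNIV. (norm (B *v slice (tensor_mat U (mat 1) *v \<psi>) a))\<^sup>2)
    = (\<Sum>a\<in>UNIV. (norm (B *v slice \<psi> a))\<^sup>2)"
  unfolding slice_tensor_mat using assms by (intro isometry_family) (simp add: unitary_def)


section \<open>Additive characters modulo M and the discrete Fourier transform\<close>

definition root_of_unity :: "nat \<Rightarrow> int \<Rightarrow> complex" where
  "root_of_unity m n = exp (2 * pi * \<i> / of_nat m * of_int n)"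

lemma root_of_unity_add: "root_of_unity m (j + k) = root_of_unity m j * root_of_unity m k"
  by (simp add: root_of_unity_def distrib_left exp_add)

lemma root_of_unity_multiple: "0 < m \<Longrightarrow> root_of_unity m (int m * k) = 1"
  using exp_integer_2pi[of "of_int k"] by (simp add: root_of_unity_def mult_ac)

lemma root_of_unity_cong:
  assumes "0 < m" "j mod int m = k mod int m"
  shows "root_of_unity m j = root_of_unity m k"
proof -
  obtain d where "j = k + int m * d"
    using assms(2) by (metis mod_eqE add.commute mod_eq_dvd_iff dvdE diff_add_cancel)
  then show ?thesis using assms(1) by (simp add: root_of_unity_add root_of_unity_multiple)
qed

lemma norm_root_of_unity [simp]: "cmod (root_of_unity m k) = 1"
  by (simp add: root_of_unity_def)

lemma root_of_unity_eq_1: "0 < m \<Longrightarrow> root_of_unity m k = 1 \<Longrightarrow> int m dvd k"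
proof -
  assume m: "0 < m" and "root_of_unity m k = 1"
  then obtain n :: int where "2 * pi / real m * of_int k = of_int (2 * n) * pi"
    unfolding root_of_unity_def exp_eq_1 by auto
  then have "real_of_int k = of_int (int m * n)" using m by (simp add: field_simps)
  then have "k = int m * n" by (simp only: of_int_eq_iff)
  then show "int m dvd k" by simp
qed

definition character :: "'m::finite mod_ring \<Rightarrow> 'm mod_ring \<Rightarrow> complex" where
  "character k y = root_of_unity CARD('m) (to_int_mod_ring k * to_int_mod_ring y)"

lemma character_commute: "character k y = character y k"
  by (simp add: character_def mult.commute)

lemma norm_character [simp]: "cmod (character k y) = 1"
  by (simp add: character_def)

lemma character_add: "character k (y + z) = character k y * character k z"
proof -
  have "to_int_mod_ring (y + z) = (to_int_mod_ring y + to_int_mod_ring z) mod int CARD('a)"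
    by transfer simp
  then have "character k (y + z)
      = root_of_unity CARD('a) (to_int_mod_ring k * (to_int_mod_ring y + to_int_mod_ring z))"
    unfolding character_def by (intro root_of_unity_cong) (auto simp: mod_mult_right_eq)
  then show ?thesis by (simp add: character_def distrib_left root_of_unity_add)
qed

lemma sum_character:
  fixes d :: "'m::finite mod_ring"
  assumes "d \<noteq> 0"
  shows "(\<Sum>k\<in>UNIV. character k d) = 0"
proof -
  have range: "to_int_mod_ring d \<in> {0..<int CARD('m)}" using range_to_int_mod_ring by blast
  moreover have "to_int_mod_ring d \<noteq> 0" using assms by simp
  ultimately have d: "0 < to_int_mod_ring d" "to_int_mod_ring d < int CARD('m)"
    unfolding atLeastLessThan_iff by linarith+
  \<comment> \<open>\<open>u\<close> is the class of 1. A nonzero \<open>d\<close> forces the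
    modulus above 1, so the representative of \<open>u\<close> is 1, and
    \<open>character u d\<close> differs from 1 because the modulus does not divide
    \<open>d\<close>. Shifting the summation index by \<open>u\<close> multiplies the sum by this
    number.\<close>
  define u :: "'m mod_ring" where "u = of_int_mod_ring 1"
  have "to_int_mod_ring u = 1" unfolding u_def using d by (intro to_int_mod_ring_of_int_mod_ring) auto
  then have "character u d \<noteq> 1"
    using root_of_unity_eq_1[of "CARD('m)" "to_int_mod_ring d"] d zdvd_not_zless
    by (auto simp: character_def)
  moreover have "(\<Sum>k\<in>UNIV. character k d) = character u d * (\<Sum>k\<in>UNIV. character k d)"
  proof -
    have "(\<Sum>k\<in>UNIV. character k d) = (\<Sum>k\<in>UNIV. character (u + k) d)"
      by (rule sum.reindex_bij_witness[of _ "\<lambda>k. u + k" "\<lambda>k. k - u"]) auto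
    also have "\<dots> = character u d * (\<Sum>k\<in>UNIV. character k d)"
      by (simp add: character_commute[of _ d] character_add sum_distrib_left)
    finally show ?thesis .
  qed
  ultimately show ?thesis by (metis mult_cancel_right1)
qed

lemma sum_cnj_character:
  fixes y z :: "'m::finite mod_ring"
  shows "(\<Sum>k\<in>UNIV. cnj (character k y) * character k z) = (if y = z then of_nat CARD('m) else 0)"
proof -
  have "cnj (character k y) * character k z = character k (z - y)" for k
  proof -
    have "character k z = character k y * character k (z - y)"
      by (simp flip: character_add)
    moreover have "cnj (character k y) * character k y = 1"
      by (simp add: mult.commute flip: complex_norm_square)
    ultimately show ?thesis by simp
  qed
  moreover have "character k 0 = 1" for k :: "'m mod_ring"
    by (simp add: character_def root_of_unity_def)
  ultimately show ?thesis using sum_character[of "z - y"] by simp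
qed

text \<open>The entries are not conjugated, so row \<open>k\<close> is the bra of the Fourier basis
  vector with label \<open>-k\<close>. With this relabelling the oracle acts on component
  \<open>k\<close> by the phase oracle for \<open>+k\<close>.\<close>

definition fourier :: "complex ^ ('m::finite mod_ring) ^ ('m mod_ring)" where
  "fourier = (\<chi> k y. character k y / of_real (sqrt CARD('m)))"

lemma fourier_isometry: "cadjoint fourier ** fourier = (mat 1 :: complex ^ ('m::finite mod_ring) ^ ('m mod_ring))"
proof -
  have "of_real (sqrt (real CARD('m))) * of_real (sqrt (real CARD('m))) = (of_nat CARD('m) :: complex)"
    by (simp flip: of_real_mult)
  then have "(cadjoint fourier ** fourier) $ y $ z = (\<Sum>k\<in>UNIV. cnj (character k y) * character k z) / of_nat CARD('m)"
    for y z :: "'m mod_ring"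
    by (simp add: matrix_matrix_mult_def cadjoint_def fourier_def flip: sum_divide_distrib)
  then show ?thesis by (simp add: vec_eq_iff sum_cnj_character mat_def)
qed

lemma phase_oracle_component: "(phase_oracle ev x y *v v) $ f = character y (ev f x) * v $ f"
proof -
  have "(phase_oracle ev x y *v v) $ f = (\<Sum>g\<in>UNIV. if g = f then character y (ev f x) * v $ f else 0)"
    unfolding matrix_vector_mult_def vec_lambda_beta
    by (intro sum.cong) (auto simp: phase_oracle_def character_def root_of_unity_def mult.assoc)
  then show ?thesis by simp
qed

lemma phase_oracle_cinner: "cinner (phase_oracle ev x y *v u) (phase_oracle ev x y *v v) = cinner u v"
proof -
  have "cnj (c * a) * (c * b) = cnj a * b" if "cmod c = 1" for a b c
  proof -
    have "cnj (c * a) * (c * b) = (c * cnj c) * (cnj a * b)" by (simp add: mult_ac)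
    then show ?thesis using that by (simp flip: complex_norm_square)
  qed
  then show ?thesis by (simp only: cinner_def phase_oracle_component norm_character)
qed

lemma purified_oracle_component:
  "(purified_oracle ev *v \<psi>) $ ((w, x, y), f) = \<psi> $ ((w, x, y - ev f x), f)"
proof -
  have "(purified_oracle ev *v \<psi>) $ ((w, x, y), f)
      = (\<Sum>q\<in>UNIV. if q = ((w, x, y - ev f x), f) then \<psi> $ q else 0)"
    unfolding matrix_vector_mult_def vec_lambda_beta
    by (intro sum.cong) (auto simp: purified_oracle_def split: prod.splits)
  then show ?thesis by simp
qed

text \<open>The slices after a Fourier transform of the register that receives the answer, with the
  other two labels untouched.\<close>

definition hat :: "complex ^ (('w::finite \<times> 'x::finite \<times> 'm::finite mod_ring) \<times> 'f::finite) \<Rightarrow> 'w \<times> 'x \<times> 'm mod_ring \<Rightarrow> complex ^ 'f" where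
  "hat \<psi> = (\<lambda>(w, x, k). \<Sum>y\<in>UNIV. fourier $ k $ y *s slice \<psi> (w, x, y))"

lemma sum_hat:
  fixes \<psi> :: "complex ^ (('w::finite \<times> 'x::finite \<times> 'm::finite mod_ring) \<times> 'f::finite)"
  shows "(\<Sum>a\<in>UNIV. (norm (B *v hat \<psi> a))\<^sup>2) = (\<Sum>a\<in>UNIV. (norm (B *v slice \<psi> a))\<^sup>2)"
  by (simp add: sum_UNIV_prod hat_def isometry_family fourier_isometry)

text \<open>The oracle shifts \<open>y\<close> by \<open>ev f x\<close>, and the Fourier transform
  turns a shift into multiplication by a character.\<close>

lemma hat_oracle: "hat (purified_oracle ev *v \<psi>) (w, x, k) = phase_oracle ev x k *v hat \<psi> (w, x, k)"
proof -
  have "(\<Sum>y\<in>UNIV. fourier $ k $ y * \<psi> $ ((w, x, y - c), f))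
      = character k c * (\<Sum>y\<in>UNIV. fourier $ k $ y * \<psi> $ ((w, x, y), f))" for c f
  proof -
    have "(\<Sum>y\<in>UNIV. fourier $ k $ y * \<psi> $ ((w, x, y - c), f))
        = (\<Sum>y\<in>UNIV. fourier $ k $ (c + y) * \<psi> $ ((w, x, y), f))"
      by (rule sum.reindex_bij_witness[of _ "\<lambda>k. c + k" "\<lambda>k. k - c"]) auto
    then show ?thesis by (simp add: fourier_def character_add sum_distrib_left mult_ac)
  qed
  then show ?thesis
    by (simp add: vec_eq_iff hat_def phase_oracle_component purified_oracle_component)
qed

subsection \<open>Reachable spaces\<close>

definition restrict_vec :: "('f::finite \<Rightarrow> 'x \<Rightarrow> 'm mod_ring) \<Rightarrow> 'x \<Rightarrow> 'm mod_ring \<Rightarrow> complex ^ 'f \<Rightarrow> complex ^ 'f" where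
  "restrict_vec ev x y v = (\<chi> f. if ev f x = y then v $ f else 0)"

text \<open>Without the normalization, lists of weight zero need no exclusion: they yield the zero
  vector.\<close>

definition unnormalized_reach_vec ::
  "('f::finite \<Rightarrow> 'x \<Rightarrow> 'm::finite mod_ring) \<Rightarrow> 'f pmf \<Rightarrow> ('x \<times> 'm mod_ring) list \<Rightarrow> complex ^ 'f" where
  "unnormalized_reach_vec ev \<delta> ps = (\<Sum>f\<in>consistent ev ps. of_real (sqrt (pmf \<delta> f)) *s ket f)"

lemma unnormalized_reach_vec_component:
  "unnormalized_reach_vec ev \<delta> ps $ f = (if f \<in> consistent ev ps then of_real (sqrt (pmf \<delta> f)) else 0)"
proof -
  have "unnormalized_reach_vec ev \<delta> ps $ f
      = (\<Sum>g\<in>consistent ev ps. if g = f then of_real (sqrt (pmf \<delta> g)) else 0)"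
    unfolding unnormalized_reach_vec_def sum_component
    by (intro sum.cong) (auto simp: ket_def axis_def)
  then show ?thesis by simp
qed

lemma unnormalized_reach_vec_Nil: "unnormalized_reach_vec ev \<delta> [] = dist_ket \<delta>"
  by (simp add: unnormalized_reach_vec_def dist_ket_def consistent_def)

lemma restrict_unnormalized_reach_vec:
  "restrict_vec ev x y (unnormalized_reach_vec ev \<delta> ps) = unnormalized_reach_vec ev \<delta> ((x, y) # ps)"
  by (auto simp: vec_eq_iff restrict_vec_def unnormalized_reach_vec_component consistent_def)

lemma unnormalized_reach_vec_eq_0:
  assumes "reach_weight ev \<delta> ps = 0"
  shows "unnormalized_reach_vec ev \<delta> ps = 0"
proof -
  have "\<forall>f\<in>consistent ev ps. pmf \<delta> f = 0"
    using assms unfolding reach_weight_def by (subst (asm) sum_nonneg_eq_0_iff) auto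
  then show ?thesis by (simp add: unnormalized_reach_vec_def)
qed

text \<open>Nonzero scalars and zero vectors do not affect a span. The empty list yields
  \<open>dist_ket \<delta>\<close>, so the case \<open>t = 0\<close> fits the same formula.\<close>

lemma reach_space_eq_span:
  fixes ev :: "'f::finite \<Rightarrow> 'x::finite \<Rightarrow> 'm::finite mod_ring"
  shows "reach_space ev \<delta> t = vec.span {unnormalized_reach_vec ev \<delta> ps |ps. length ps = min t CARD('x)}"
proof (cases "t = 0")
  case True
  then show ?thesis by (simp add: reach_space_def unnormalized_reach_vec_Nil)
next
  case False
  let ?R = "{reach_vec ev \<delta> ps |ps. length ps = min t CARD('x) \<and> reach_weight ev \<delta> ps \<noteq> 0}"
  let ?N = "{unnormalized_reach_vec ev \<delta> ps |ps. length ps = min t CARD('x)}"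
  have reach_vec: "reach_vec ev \<delta> ps
      = of_real (1 / sqrt (reach_weight ev \<delta> ps)) *s unnormalized_reach_vec ev \<delta> ps" for ps
    by (simp add: reach_vec_def unnormalized_reach_vec_def)
  have "?R \<subseteq> vec.span ?N"
  proof
    fix v assume "v \<in> ?R"
    then obtain ps where "v = reach_vec ev \<delta> ps" "length ps = min t CARD('x)" by blast
    then show "v \<in> vec.span ?N"
      unfolding reach_vec by (auto intro!: vec.span_scale intro: vec.span_base)
  qed
  moreover have "?N \<subseteq> vec.span ?R"
  proof
    fix v assume "v \<in> ?N"
    then obtain ps where v: "v = unnormalized_reach_vec ev \<delta> ps" and ps: "length ps = min t CARD('x)"
      by blast
    show "v \<in> vec.span ?R"
    proof (cases "reach_weight ev \<delta> ps = 0")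
      case True
      then show ?thesis unfolding v by (simp add: unnormalized_reach_vec_eq_0 vec.span_zero)
    next
      case False
      then have "v = of_real (sqrt (reach_weight ev \<delta> ps)) *s reach_vec ev \<delta> ps"
        unfolding v reach_vec vec.scale_scale by (simp flip: of_real_mult)
      moreover have "reach_vec ev \<delta> ps \<in> vec.span ?R"
        using ps False by (intro vec.span_base) blast
      ultimately show ?thesis by (simp add: vec.span_scale)
    qed
  qed
  ultimately have "vec.span ?R = vec.span ?N"
    by (intro equalityI vec.span_minimal) (auto simp: vec.subspace_span)
  then show ?thesis using False by (simp add: reach_space_def)
qed

text \<open>An input is determined by its values at all points, so the full space contains all kets in
  the support of \<open>\<delta>\<close>.\<close>

lemma full_reach_space:
  fixes ev :: "'f::finite \<Rightarrow> 'x::finite \<Rightarrow> 'm::finite mod_ring"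
  assumes inj: "inj ev" and t: "CARD('x) \<le> t"
  shows "unnormalized_reach_vec ev \<delta> ps \<in> reach_space ev \<delta> t"
proof -
  obtain xs :: "'x list" where xs: "set xs = UNIV" "distinct xs"
    using finite_distinct_list[OF finite[of "UNIV :: 'x set"]] by blast
  then have len: "length xs = CARD('x)" by (metis distinct_card)
  have "of_real (sqrt (pmf \<delta> f)) *s ket f \<in> reach_space ev \<delta> t" for f
  proof -
    let ?qs = "map (\<lambda>x. (x, ev f x)) xs"
    have "consistent ev ?qs = {f}"
      using xs inj by (auto simp: consistent_def inj_def fun_eq_iff)
    then have "of_real (sqrt (pmf \<delta> f)) *s ket f = unnormalized_reach_vec ev \<delta> ?qs"
      by (simp add: unnormalized_reach_vec_def)
    then show ?thesis
      unfolding reach_space_eq_span using len t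
      by (intro vec.span_base) (auto intro!: exI[of _ ?qs])
  qed
  then show ?thesis
    unfolding unnormalized_reach_vec_def by (intro vec.subspace_sum subspace_reach_space) auto
qed

text \<open>Imposing one more answer prepends a pair to the list that defines a generator.\<close>

lemma restrict_reach_space:
  fixes ev :: "'f::finite \<Rightarrow> 'x::finite \<Rightarrow> 'm::finite mod_ring"
  assumes inj: "inj ev" and v: "v \<in> reach_space ev \<delta> t"
  shows "restrict_vec ev x y v \<in> reach_space ev \<delta> (Suc t)"
  using v[unfolded reach_space_eq_span]
proof (induction rule: vec.span_induct_alt)
  case base
  have "restrict_vec ev x y 0 = 0" by (simp add: vec_eq_iff restrict_vec_def)
  then show ?case by (simp add: vec.subspace_0 subspace_reach_space)
next
  case (step c u v)
  then obtain ps where u: "u = unnormalized_reach_vec ev \<delta> ps" and ps: "length ps = min t CARD('x)"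
    by blast
  have "restrict_vec ev x y u \<in> reach_space ev \<delta> (Suc t)"
  proof (cases "Suc t \<le> CARD('x)")
    case True
    then have "length ((x, y) # ps) = min (Suc t) CARD('x)" using ps by simp
    then show ?thesis
      unfolding u restrict_unnormalized_reach_vec reach_space_eq_span
      by (intro vec.span_base) blast
  next
    \<comment> \<open>The lists have already reached their maximal length, so the saturated space
      takes over.\<close>
    case False
    then show ?thesis
      unfolding u restrict_unnormalized_reach_vec by (intro full_reach_space inj) simp
  qed
  moreover have "restrict_vec ev x y (c *s u + v) = c *s restrict_vec ev x y u + restrict_vec ev x y v"
    by (simp add: vec_eq_iff restrict_vec_def)
  ultimately show ?case
    using step by (simp add: vec.subspace_add vec.subspace_scale subspace_reach_space)
qed

text \<open>The phase depends on \<open>f\<close> only through the answer \<open>ev f x\<close>, so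
  it is constant on each restriction.\<close>

lemma phase_oracle_restrict: "phase_oracle ev x k *v v = (\<Sum>y\<in>UNIV. character k y *s restrict_vec ev x y v)"
proof (intro vec_eq_iff[THEN iffD2] allI)
  fix f
  have "(\<Sum>y\<in>UNIV. character k y *s restrict_vec ev x y v) $ f
      = (\<Sum>y\<in>UNIV. if y = ev f x then character k y * v $ f else 0)"
    unfolding sum_component by (intro sum.cong) (auto simp: restrict_vec_def)
  then show "(phase_oracle ev x k *v v) $ f = (\<Sum>y\<in>UNIV. character k y *s restrict_vec ev x y v) $ f"
    by (simp add: phase_oracle_component)
qed

lemma slice_purified_oracle:
  "slice (purified_oracle ev *v \<psi>) (w, x, y) = (\<Sum>z\<in>UNIV. restrict_vec ev x z (slice \<psi> (w, x, y - z)))"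
proof (intro vec_eq_iff[THEN iffD2] allI)
  fix f
  have "(\<Sum>z\<in>UNIV. restrict_vec ev x z (slice \<psi> (w, x, y - z))) $ f
      = (\<Sum>z\<in>UNIV. if z = ev f x then \<psi> $ ((w, x, y - z), f) else 0)"
    unfolding sum_component by (intro sum.cong) (auto simp: restrict_vec_def)
  then show "slice (purified_oracle ev *v \<psi>) (w, x, y) $ f
      = (\<Sum>z\<in>UNIV. restrict_vec ev x z (slice \<psi> (w, x, y - z))) $ f"
    by (simp add: purified_oracle_component)
qed

lemma phase_oracle_reach_space:
  assumes "inj ev" "v \<in> reach_space ev \<delta> t"
  shows "phase_oracle ev x k *v v \<in> reach_space ev \<delta> (Suc t)"
  unfolding phase_oracle_restrict using assms
  by (intro vec.subspace_sum vec.subspace_scale subspace_reach_space restrict_reach_space)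

lemma slice_tensor_mat_reach_space:
  assumes "\<And>a. slice \<psi> a \<in> reach_space ev \<delta> t"
  shows "slice (tensor_mat U (mat 1) *v \<psi>) a \<in> reach_space ev \<delta> t"
  unfolding slice_tensor_mat using assms
  by (intro vec.subspace_sum vec.subspace_scale subspace_reach_space)

text \<open>A unitary of the algorithm only forms linear combinations of slices. A query sums
  restrictions of slices and raises the index of the space by one.\<close>

lemma slice_state_reach_space:
  assumes inj: "inj ev"
  shows "slice (state ev \<delta> U q t) a \<in> reach_space ev \<delta> t"
proof (induction t arbitrary: a)
  case 0
  have "dist_ket \<delta> \<in> reach_space ev \<delta> 0" by (simp add: reach_space_def vec.span_base)
  then show ?case
    by (auto intro!: slice_tensor_mat_reach_space vec.subspace_scale subspace_reach_space simp: slice_tensor_vec)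
next
  case (Suc t)
  have "slice (purified_oracle ev *v state ev \<delta> U q t) b \<in> reach_space ev \<delta> (Suc t)" for b
  proof (cases b)
    case (fields w x y)
    then show ?thesis
      by (simp only: slice_purified_oracle)
        (intro vec.subspace_sum subspace_reach_space restrict_reach_space inj Suc)
  qed
  then show ?case by (auto intro: slice_tensor_mat_reach_space)
qed

section \<open>Norm preservation along the algorithm\<close>

lemma norm_phase_oracle: "norm (phase_oracle ev x y *v v) = norm v"
  by (simp add: norm_eq_sqrt_inner inner_eq_Re_cinner phase_oracle_cinner)

lemma norm_purified_oracle:
  fixes \<psi> :: "complex ^ (('w::finite \<times> 'x::finite \<times> 'm::finite mod_ring) \<times> 'f::finite)"
  shows "norm (purified_oracle ev *v \<psi>) = norm \<psi>"
proof -
  have "(\<Sum>a\<in>UNIV. (norm (hat (purified_oracle ev *v \<psi>) a))\<^sup>2) = (\<Sum>a\<in>UNIV. (norm (hat \<psi> a))\<^sup>2)"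
    by (simp add: sum_UNIV_prod hat_oracle norm_phase_oracle)
  then have "(norm (purified_oracle ev *v \<psi>))\<^sup>2 = (norm \<psi>)\<^sup>2"
    using sum_hat[of "mat 1" \<psi>] sum_hat[of "mat 1" "purified_oracle ev *v \<psi>"]
    by (simp add: norm_slices)
  then show ?thesis by simp
qed

lemma norm_tensor_mat_unitary: "unitary U \<Longrightarrow> norm (tensor_mat U (mat 1) *v \<psi>) = norm \<psi>"
  using unitary_slices[of U "mat 1" \<psi>] by (simp flip: norm_slices)

lemma norm_dist_ket: "norm (dist_ket \<delta>) = 1" for \<delta> :: "'f::finite pmf"
proof -
  have "dist_ket \<delta> $ f = of_real (sqrt (pmf \<delta> f))" for f
  proof -
    have "dist_ket \<delta> $ f = (\<Sum>g\<in>UNIV. if g = f then of_real (sqrt (pmf \<delta> g)) else 0)"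
      unfolding dist_ket_def sum_component by (intro sum.cong) (auto simp: ket_def axis_def)
    then show ?thesis by simp
  qed
  then have "(norm (dist_ket \<delta>))\<^sup>2 = (\<Sum>f\<in>UNIV. pmf \<delta> f)"
    by (simp add: norm_vec_square)
  also have "\<dots> = 1\<^sup>2" by (simp add: sum_pmf_eq_1)
  finally show ?thesis by (rule power2_eq_imp_eq) auto
qed

lemma sum_ket: "(\<Sum>a\<in>UNIV. (cmod (ket q $ a))\<^sup>2) = 1"
proof -
  have "(\<Sum>a\<in>UNIV. (cmod (ket q $ a))\<^sup>2) = (\<Sum>a\<in>UNIV. if a = q then 1 else 0)"
    by (intro sum.cong) (auto simp: ket_def axis_def)
  then show ?thesis by simp
qed

lemma norm_state:
  assumes "query_algorithm T U" "t \<le> T"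
  shows "norm (state ev \<delta> U q t) = 1"
  using assms(2)
proof (induction t)
  case 0
  have "(norm (tensor_vec (ket q) (dist_ket \<delta>)))\<^sup>2 = 1\<^sup>2"
    unfolding norm_slices by (simp add: slice_tensor_vec norm_scale norm_dist_ket sum_ket)
  then have "norm (tensor_vec (ket q) (dist_ket \<delta>)) = 1" by (rule power2_eq_imp_eq) auto
  then show ?case using assms by (simp add: query_algorithm_def norm_tensor_mat_unitary)
next
  case (Suc t)
  then show ?case
    using assms(1) by (simp add: query_algorithm_def norm_tensor_mat_unitary norm_purified_oracle)
qed


subsection \<open>The progress measure\<close>

lemma valid_proj_component: "(valid_proj F z *v v) $ f = (if z \<in> F f then v $ f else 0)"
proof -
  have "(ketbra (ket g) (ket g) *v v) $ f = (if g = f then v $ f else 0)" for g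
  proof -
    have "(ketbra (ket g) (ket g) *v v) $ f
        = (\<Sum>h\<in>UNIV. if h = g then (if g = f then v $ f else 0) else 0)"
      unfolding matrix_vector_mult_def vec_lambda_beta
      by (intro sum.cong) (auto simp: ketbra_def ket_def axis_def)
    then show ?thesis by simp
  qed
  then show ?thesis
    by (simp add: valid_proj_def matrix_vector_mult_sum_left)
qed

lemma norm_valid_proj_le: "norm (valid_proj F z *v v) \<le> norm v"
proof (rule power2_le_imp_le)
  show "(norm (valid_proj F z *v v))\<^sup>2 \<le> (norm v)\<^sup>2"
    unfolding norm_vec_square by (intro sum_mono) (simp add: valid_proj_component)
qed simp

lemma slice_success_proj:
  "slice (success_proj F *v \<psi>) a = valid_proj F (fst (fst a)) *v slice \<psi> a"
proof (intro vec_eq_iff[THEN iffD2] allI)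
  fix f
  let ?M = "\<lambda>z. tensor_mat (tensor_mat (tensor_mat (ketbra (ket z) (ket z)) (mat 1)) (mat 1)) (valid_proj F z)"
  have entry: "?M z $ (a, f) $ (b, g)
      = (if z = fst (fst a) then if b = a then valid_proj F z $ f $ g else 0 else 0)" for z b g
    by (cases a; cases b) (auto simp: tensor_mat_def ketbra_def ket_def axis_def mat_def)
  have "(?M z *v \<psi>) $ (a, f) = (if z = fst (fst a) then (valid_proj F z *v slice \<psi> a) $ f else 0)" for z
  proof -
    have "(?M z *v \<psi>) $ (a, f) = (\<Sum>b\<in>UNIV. \<Sum>g\<in>UNIV. ?M z $ (a, f) $ (b, g) * \<psi> $ (b, g))"
      by (simp add: matrix_vector_mult_def sum_UNIV_prod)
    also have "\<dots> = (\<Sum>b\<in>UNIV. if b = a then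
        (if z = fst (fst a) then (valid_proj F z *v slice \<psi> a) $ f else 0) else 0)"
      unfolding entry by (intro sum.cong) (auto simp: matrix_vector_mult_def)
    finally show ?thesis by simp
  qed
  then show "slice (success_proj F *v \<psi>) a $ f = (valid_proj F (fst (fst a)) *v slice \<psi> a) $ f"
    by (simp add: success_proj_def matrix_vector_mult_sum_left)
qed

section \<open>The progress measure as a weighted sum of spectral masses, its growth and its final
  lower bound\<close>

context mla
begin

definition energy :: "complex ^ ('a::finite \<times> 'f) \<Rightarrow> real" where
  "energy \<psi> = (\<Sum>a\<in>UNIV. \<Sum>i\<le>l. \<kappa> ^ i * (norm (\<Lambda> i *v slice \<psi> a))\<^sup>2)"

lemma energy_nonneg: "0 \<le> energy \<psi>"
  unfolding energy_def using kappa_gt_1 by (intro sum_nonneg) auto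

text \<open>With the level outermost, the inner sums have the form preserved by isometries on the
  labels.\<close>

lemma energy_swap: "energy \<psi> = (\<Sum>i\<le>l. \<kappa> ^ i * (\<Sum>a\<in>UNIV. (norm (\<Lambda> i *v slice \<psi> a))\<^sup>2))"
  unfolding energy_def by (subst sum.swap) (simp add: sum_distrib_left)

lemma progress_eq_energy: "progress ev \<delta> \<Gamma> U q t = of_real (energy (state ev \<delta> U q t))"
  unfolding progress_def trace_partial_trace_fst cinner_Gamma energy_def by simp

lemma energy_unitary: "unitary U \<Longrightarrow> energy (tensor_mat U (mat 1) *v \<psi>) = energy \<psi>"
  unfolding energy_swap by (simp add: unitary_slices)

lemma energy_hat:
  fixes \<psi> :: "complex ^ (('w::finite \<times> 'x \<times> 'm mod_ring) \<times> 'f)"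
  shows "energy \<psi> = (\<Sum>a\<in>UNIV. \<Sum>i\<le>l. \<kappa> ^ i * (norm (\<Lambda> i *v hat \<psi> a))\<^sup>2)"
proof -
  have "energy \<psi> = (\<Sum>i\<le>l. \<Sum>a\<in>UNIV. \<kappa> ^ i * (norm (\<Lambda> i *v hat \<psi> a))\<^sup>2)"
    unfolding energy_swap by (simp add: sum_hat flip: sum_distrib_left)
  then show ?thesis by (subst sum.swap)
qed

lemma hat_reach_space:
  assumes "\<And>a. slice \<psi> a \<in> reach_space ev \<delta> t"
  shows "hat \<psi> a \<in> reach_space ev \<delta> t"
  using assms
  by (cases a) (auto simp: hat_def intro!: vec.subspace_sum vec.subspace_scale subspace_reach_space)

lemma phase_oracle_ladder_step:
  assumes inj: "inj ev" and v: "v \<in> reach_space ev \<delta> t" and mu: "0 \<le> \<mu>"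
    and bound: "\<And>i. i < l \<Longrightarrow> opnorm (\<Lambda> (i + 1) ** reach_proj ev \<delta> (t + 1) ** phase_oracle ev x y
      ** reach_proj ev \<delta> t ** \<Lambda> i) \<le> \<mu>"
  shows "(\<Sum>i\<le>l. \<kappa> ^ i * (norm (\<Lambda> i *v (phase_oracle ev x y *v v)))\<^sup>2)
    \<le> (1 + (\<kappa> - 1) / sqrt \<kappa> * \<mu>)\<^sup>2 * (\<Sum>i\<le>l. \<kappa> ^ i * (norm (\<Lambda> i *v v))\<^sup>2)"
proof -
  \<comment> \<open>The projectors are known only up to \<open>l\<close>. Extension by zero supplies
    the family over all naturals that \<open>ladder_step\<close> expects.\<close>
  define L where "L i u = (if i \<le> l then \<Lambda> i *v u else 0)" for i u
  let ?O = "(*v) (phase_oracle ev x y)"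
  have "(\<Sum>i\<le>l. \<kappa> ^ i * (norm (L i (?O v)))\<^sup>2)
    \<le> (1 + (\<kappa> - 1) / sqrt \<kappa> * \<mu>)\<^sup>2 * (\<Sum>i\<le>l. \<kappa> ^ i * (norm (L i v))\<^sup>2)"
  proof (rule ladder_step)
    show "linear (L i)" for i
    proof (cases "i \<le> l")
      case True
      then have "L i = (*v) (\<Lambda> i)" by (simp add: L_def fun_eq_iff)
      then show ?thesis by simp
    next
      case False
      then have "L i = (\<lambda>_. 0)" by (simp add: L_def fun_eq_iff)
      then show ?thesis by (simp add: linear_iff)
    qed
    show "inner (L i u) w = inner u (L i w)" for i u w
      by (simp add: L_def inner_eq_Re_cinner Lambda_selfadjoint)
    show "L i (L j u) = (if i = j then L i u else 0)" for i j u
      by (simp add: L_def Lambda_Lambda)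
    show "(\<Sum>i\<le>l. L i u) = u" for u
      by (simp add: L_def Lambda_complete)
    show "L i u = 0" if "i > l" for i u using that by (simp add: L_def)
    show "linear ?O" by simp
    show "inner (?O u) (?O w) = inner u w" for u w
      by (simp add: inner_eq_Re_cinner phase_oracle_cinner)
    show "L i (?O (L j u)) = 0" if "\<bar>int i - int j\<bar> > 1" for i j u
      using that by (simp add: L_def Lambda_phase_oracle_Lambda)
    show "norm (L (Suc i) (?O (L i v))) \<le> \<mu> * norm (L i v)" if i: "i < l" for i
    proof -
      let ?A = "\<Lambda> (i + 1) ** reach_proj ev \<delta> (t + 1) ** phase_oracle ev x y ** reach_proj ev \<delta> t ** \<Lambda> i"
      have u: "\<Lambda> i *v v \<in> reach_space ev \<delta> t" using i v by (intro Lambda_reach_space) auto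
      \<comment> \<open>Both reachable projectors act as the identity here: the spectral component
        stays in the space for \<open>t\<close>, and its image under the phase oracle lies in the
        space for \<open>t + 1\<close>.\<close>
      have "?A *v (\<Lambda> i *v v) = \<Lambda> (i + 1) *v (?O (\<Lambda> i *v v))"
        using i u phase_oracle_reach_space[OF inj u, of x y]
        by (simp add: Lambda_Lambda reach_proj_def orth_proj_fixed subspace_reach_space
            flip: matrix_vector_mul_assoc)
      then have "norm (L (Suc i) (?O (L i v))) = norm (?A *v (\<Lambda> i *v v))" using i by (simp add: L_def)
      also have "\<dots> \<le> opnorm ?A * norm (\<Lambda> i *v v)" by (rule opnorm_bound)
      also have "\<dots> \<le> \<mu> * norm (\<Lambda> i *v v)" using bound[OF i] by (intro mult_right_mono) auto
      finally show ?thesis using i by (simp add: L_def)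
    qed
  qed (use kappa_gt_1 mu in auto)
  then show ?thesis by (simp add: L_def)
qed

lemma energy_oracle:
  fixes \<psi> :: "complex ^ (('w::finite \<times> 'x \<times> 'm mod_ring) \<times> 'f)"
  assumes inj: "inj ev" and \<psi>: "\<And>a. slice \<psi> a \<in> reach_space ev \<delta> t" and mu: "0 \<le> \<mu>"
    and bound: "\<And>i x y. i < l \<Longrightarrow> opnorm (\<Lambda> (i + 1) ** reach_proj ev \<delta> (t + 1) ** phase_oracle ev x y
      ** reach_proj ev \<delta> t ** \<Lambda> i) \<le> \<mu>"
  shows "energy (purified_oracle ev *v \<psi>) \<le> (1 + (\<kappa> - 1) / sqrt \<kappa> * \<mu>)\<^sup>2 * energy \<psi>"
  unfolding energy_hat sum_distrib_left[of _ _ UNIV]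
proof (intro sum_mono)
  fix a :: "'w \<times> 'x \<times> 'm mod_ring"
  obtain w x k where a: "a = (w, x, k)" by (cases a)
  show "(\<Sum>i\<le>l. \<kappa> ^ i * (norm (\<Lambda> i *v hat (purified_oracle ev *v \<psi>) a))\<^sup>2)
    \<le> (1 + (\<kappa> - 1) / sqrt \<kappa> * \<mu>)\<^sup>2 * (\<Sum>i\<le>l. \<kappa> ^ i * (norm (\<Lambda> i *v hat \<psi> a))\<^sup>2)"
    unfolding a hat_oracle
    by (rule phase_oracle_ladder_step[OF inj hat_reach_space[OF \<psi>] mu bound])
qed

text \<open>Every level has weight at least 1, and each level that survives in \<open>g\<close> has
  weight at least \<open>lam\<close>, an excess of at least \<open>lam - 1\<close>.\<close>

lemma energy_ge_good_part:
  fixes v :: "complex ^ 'f"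
  assumes "1 < lam"
  defines "g \<equiv> v - bad_proj \<Gamma> lam *v v"
  shows "(\<Sum>i\<le>l. \<kappa> ^ i * (norm (\<Lambda> i *v v))\<^sup>2) \<ge> (norm v)\<^sup>2 + (lam - 1) * (norm g)\<^sup>2"
proof -
  have Lg: "\<Lambda> i *v g = (if \<kappa> ^ i < lam then 0 else \<Lambda> i *v v)" if "i \<le> l" for i
    using that unfolding g_def bad_proj_eq
    by (simp add: matrix_vector_mult_diff_distrib matrix_vector_mult_sum_right Lambda_Lambda sum.delta)
  have "(norm v)\<^sup>2 + (lam - 1) * (norm g)\<^sup>2
      = (\<Sum>i\<le>l. (norm (\<Lambda> i *v v))\<^sup>2 + (lam - 1) * (norm (\<Lambda> i *v g))\<^sup>2)"
    unfolding norm_Lambda[of v] norm_Lambda[of g] by (simp add: sum.distrib sum_distrib_left)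
  also have "\<dots> \<le> (\<Sum>i\<le>l. \<kappa> ^ i * (norm (\<Lambda> i *v v))\<^sup>2)"
  proof (rule sum_mono)
    fix i assume "i \<in> {..l}"
    then have i: "i \<le> l" by simp
    have "1 \<le> \<kappa> ^ i" using kappa_gt_1 by simp
    then show "(norm (\<Lambda> i *v v))\<^sup>2 + (lam - 1) * (norm (\<Lambda> i *v g))\<^sup>2 \<le> \<kappa> ^ i * (norm (\<Lambda> i *v v))\<^sup>2"
      using mult_right_mono[of lam "\<kappa> ^ i" "(norm (\<Lambda> i *v v))\<^sup>2"]
        mult_right_mono[of 1 "\<kappa> ^ i" "(norm (\<Lambda> i *v v))\<^sup>2"]
      by (auto simp: Lg[OF i] algebra_simps)
  qed
  finally show ?thesis .
qed

lemma energy_ge_of_success: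
  fixes \<psi> :: "complex ^ ((('z::finite \<times> 'v::finite) \<times> 'x \<times> 'm mod_ring) \<times> 'f)"
  assumes lam: "1 < lam" and \<psi>: "norm \<psi> = 1"
    and succ: "(norm (success_proj F *v \<psi>))\<^sup>2 \<ge> p" and eta: "0 < \<eta>" "\<eta> \<le> p"
    and bad: "\<And>z. (opnorm (valid_proj F z ** bad_proj \<Gamma> lam))\<^sup>2 \<le> \<eta>"
  shows "energy \<psi> \<ge> 1 + (lam - 1) * (sqrt p - sqrt \<eta>)\<^sup>2"
proof -
  \<comment> \<open>\<open>b\<close> applies the bad projector to the input register only. The
    labels, and with them the output \<open>z\<close>, are kept, so the hypothesis for each
    \<open>z\<close> applies slice by slice.\<close>
  define b where "b = (\<chi> q. (bad_proj \<Gamma> lam *v slice \<psi> (fst q)) $ snd q)"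
  define g where "g = \<psi> - b"
  have b: "slice b a = bad_proj \<Gamma> lam *v slice \<psi> a" for a
    by (simp add: vec_eq_iff b_def)
  have g: "slice g a = slice \<psi> a - bad_proj \<Gamma> lam *v slice \<psi> a" for a
    unfolding b[symmetric] by (simp add: vec_eq_iff g_def)
  have "1 + (lam - 1) * (norm g)\<^sup>2
      = (\<Sum>a\<in>UNIV. (norm (slice \<psi> a))\<^sup>2 + (lam - 1) * (norm (slice g a))\<^sup>2)"
    using norm_slices[of \<psi>] norm_slices[of g] \<psi> by (simp add: sum.distrib sum_distrib_left)
  also have "\<dots> \<le> energy \<psi>"
    unfolding energy_def g by (intro sum_mono energy_ge_good_part lam)
  finally have energy: "1 + (lam - 1) * (norm g)\<^sup>2 \<le> energy \<psi>" .
  have "norm (success_proj F *v b) \<le> sqrt \<eta>"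
  proof (rule power2_le_imp_le)
    have "(norm (success_proj F *v b))\<^sup>2 \<le> (\<Sum>a\<in>UNIV. \<eta> * (norm (slice \<psi> a))\<^sup>2)"
      unfolding norm_slices slice_success_proj b
    proof (intro sum_mono)
      fix a :: "('z \<times> 'v) \<times> 'x \<times> 'm mod_ring"
      let ?A = "valid_proj F (fst (fst a)) ** bad_proj \<Gamma> lam"
      have "norm (?A *v slice \<psi> a) \<le> opnorm ?A * norm (slice \<psi> a)" by (rule opnorm_bound)
      then have "(norm (?A *v slice \<psi> a))\<^sup>2 \<le> (opnorm ?A)\<^sup>2 * (norm (slice \<psi> a))\<^sup>2"
        by (metis norm_ge_zero power_mono power_mult_distrib)
      also have "\<dots> \<le> \<eta> * (norm (slice \<psi> a))\<^sup>2" by (intro mult_right_mono bad) simp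
      finally show "(norm (valid_proj F (fst (fst a)) *v (bad_proj \<Gamma> lam *v slice \<psi> a)))\<^sup>2
          \<le> \<eta> * (norm (slice \<psi> a))\<^sup>2"
        by (simp add: matrix_vector_mul_assoc)
    qed
    also have "\<dots> = \<eta>" using norm_slices[of \<psi>] \<psi> by (simp flip: sum_distrib_left)
    finally show "(norm (success_proj F *v b))\<^sup>2 \<le> (sqrt \<eta>)\<^sup>2" using eta by simp
  qed (use eta in simp)
  moreover have "norm (success_proj F *v g) \<le> norm g"
  proof (rule power2_le_imp_le)
    show "(norm (success_proj F *v g))\<^sup>2 \<le> (norm g)\<^sup>2"
      unfolding norm_slices slice_success_proj by (intro sum_mono power_mono norm_valid_proj_le) simp
  qed simp
  moreover have "success_proj F *v \<psi> = success_proj F *v b + success_proj F *v g"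
    by (simp add: g_def matrix_vector_mult_diff_distrib)
  moreover have "sqrt p \<le> norm (success_proj F *v \<psi>)"
    using succ by (simp add: real_le_lsqrt real_sqrt_le_iff[of p, symmetric] del: real_sqrt_le_iff)
  ultimately have "sqrt p - sqrt \<eta> \<le> norm g"
    using norm_triangle_ineq[of "success_proj F *v b" "success_proj F *v g"] by simp
  \<comment> \<open>Squaring preserves the inequality since the left side is nonnegative by
    \<open>\<eta> \<le> p\<close>.\<close>
  then have "(sqrt p - sqrt \<eta>)\<^sup>2 \<le> (norm g)\<^sup>2" using eta by (intro power_mono) auto
  then have "(lam - 1) * (sqrt p - sqrt \<eta>)\<^sup>2 \<le> (lam - 1) * (norm g)\<^sup>2" using lam by (intro mult_left_mono) auto
  then show ?thesis using energy by linarith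
qed

end

section \<open>Initial value, growth per query and final value of the progress measure\<close>

theorem theorem4p3:
  fixes ev :: "'f::finite \<Rightarrow> 'x::finite \<Rightarrow> 'm::finite mod_ring"
    and F :: "'f \<Rightarrow> 'z::finite set"
    and \<delta> :: "'f pmf"
    and \<Gamma> :: "complex ^ 'f ^ 'f"
    and \<Lambda> :: "nat \<Rightarrow> complex ^ 'f ^ 'f"
    and l :: nat
    and \<kappa> lam \<epsilon> \<eta> :: real
  assumes "inj ev"
    and "\<kappa> > 1"
    and "mla_matrix ev \<delta> \<kappa> l \<Lambda> \<Gamma>"
    and "\<Gamma> *v dist_ket \<delta> = dist_ket \<delta>"
    and "1 < lam" and "lam \<le> \<kappa> ^ l"
    and "0 \<le> \<epsilon>" and "\<epsilon> \<le> 1"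
    and "0 < \<eta>" and "\<eta> \<le> 1 - \<epsilon>"
    and "\<And>z. (opnorm (valid_proj F z ** bad_proj \<Gamma> lam))\<^sup>2 \<le> \<eta>"
  shows "(\<forall>T (U :: nat \<Rightarrow> complex ^ ('w::finite \<times> 'x \<times> 'm mod_ring) ^ ('w \<times> 'x \<times> 'm mod_ring)) q.
            query_algorithm T U \<longrightarrow> progress ev \<delta> \<Gamma> U q 0 = 1) \<and>
         (\<forall>T (U :: nat \<Rightarrow> complex ^ ('w \<times> 'x \<times> 'm mod_ring) ^ ('w \<times> 'x \<times> 'm mod_ring)) q t.
            query_algorithm T U \<and> t < T \<longrightarrow>
            progress ev \<delta> \<Gamma> U q (t + 1) / progress ev \<delta> \<Gamma> U q t
              \<le> of_real ((1 + Max {(\<kappa> - 1) / sqrt \<kappa> *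
                    opnorm (\<Lambda> (i + 1) ** reach_proj ev \<delta> (t + 1) ** phase_oracle ev x y
                              ** reach_proj ev \<delta> t ** \<Lambda> i) |i x y. i < l})\<^sup>2)) \<and>
         (\<forall>T (U :: nat \<Rightarrow> complex ^ (('z \<times> 'v::finite) \<times> 'x \<times> 'm mod_ring)
                                  ^ (('z \<times> 'v) \<times> 'x \<times> 'm mod_ring)) q.
            query_algorithm T U \<and> solves ev \<delta> F T U q (1 - \<epsilon>) \<longrightarrow>
            progress ev \<delta> \<Gamma> U q T
              \<ge> of_real (1 + (lam - 1) * (sqrt (1 - \<epsilon>) - sqrt \<eta>)\<^sup>2))"
proof (intro conjI allI impI)
  interpret mla ev \<delta> \<kappa> l \<Lambda> \<Gamma> by unfold_locales (rule assms(3))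
  fix T and U :: "nat \<Rightarrow> complex ^ ('w::finite \<times> 'x \<times> 'm mod_ring) ^ ('w \<times> 'x \<times> 'm mod_ring)" and q
  assume U: "query_algorithm T U"
  \<comment> \<open>The spectral sum is the quadratic form of \<open>\<Gamma>\<close> at a unit
    vector fixed by \<open>\<Gamma>\<close>.\<close>
  have "of_real (\<Sum>i\<le>l. \<kappa> ^ i * (norm (\<Lambda> i *v dist_ket \<delta>))\<^sup>2) = (1 :: complex)"
    using cinner_Gamma[of "dist_ket \<delta>"] assms(4) by (simp add: cinner_self norm_dist_ket)
  then have start: "(\<Sum>i\<le>l. \<kappa> ^ i * (norm (\<Lambda> i *v dist_ket \<delta>))\<^sup>2) = 1"
    by (metis of_real_eq_1_iff)
  have "energy (state ev \<delta> U q 0) = energy (tensor_vec (ket q) (dist_ket \<delta>))"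
    using U by (simp add: query_algorithm_def energy_unitary)
  also have "\<dots> = (\<Sum>a\<in>UNIV. (cmod (ket q $ a))\<^sup>2
      * (\<Sum>i\<le>l. \<kappa> ^ i * (norm (\<Lambda> i *v dist_ket \<delta>))\<^sup>2))"
    by (simp add: energy_def slice_tensor_vec vector_scalar_commute norm_scale power_mult_distrib
        sum_distrib_left mult_ac)
  also have "\<dots> = 1" by (simp add: start sum_ket)
  finally show "progress ev \<delta> \<Gamma> U q 0 = 1" unfolding progress_eq_energy by simp
next
  interpret mla ev \<delta> \<kappa> l \<Lambda> \<Gamma> by unfold_locales (rule assms(3))
  fix T and U :: "nat \<Rightarrow> complex ^ ('w::finite \<times> 'x \<times> 'm mod_ring) ^ ('w \<times> 'x \<times> 'm mod_ring)" and q t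
  assume "query_algorithm T U \<and> t < T"
  then have U: "unitary (U (Suc t))" by (simp add: query_algorithm_def)
  define A where "A i x y = opnorm (\<Lambda> (i + 1) ** reach_proj ev \<delta> (t + 1) ** phase_oracle ev x y
    ** reach_proj ev \<delta> t ** \<Lambda> i)" for i x y
  let ?c = "(\<kappa> - 1) / sqrt \<kappa>"
  let ?S = "{?c * A i x y |i x y. i < l}"
  define M where "M = Max ?S"
  have c: "0 < ?c" using assms(2) by simp
  \<comment> \<open>Written as a finite union of finite ranges, the set is visibly finite, as
    \<open>Max\<close> requires.\<close>
  have "?S = (\<Union>i\<in>{..<l}. \<Union>x. range (\<lambda>y. ?c * A i x y))" by blast
  then have "finite ?S" by simp
  then have M: "?c * A i x y \<le> M" if "i < l" for i x y
    unfolding M_def using that by (intro Max_ge) auto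
  \<comment> \<open>For \<open>l = 0\<close> the bounds on \<open>lam\<close> would contradict each
    other. Hence the set under \<open>Max\<close> is nonempty and \<open>M\<close> is
    nonnegative.\<close>
  have "l \<noteq> 0" using assms(5,6) by (intro notI) simp
  have "0 \<le> ?c * A 0 undefined undefined"
    using c by (intro mult_nonneg_nonneg) (auto simp: A_def opnorm_nonneg)
  also have "\<dots> \<le> M" using \<open>l \<noteq> 0\<close> by (intro M) simp
  finally have "0 \<le> M" .
  \<comment> \<open>The factor \<open>?c\<close> sits inside the maximum, so \<open>M / ?c\<close>
    is the bound on the operator norms themselves.\<close>
  have bound: "A i x y \<le> M / ?c" if "i < l" for i x y
    unfolding pos_le_divide_eq[OF c] using M[OF that, of x y] by (simp only: mult.commute)
  have "energy (state ev \<delta> U q (Suc t)) = energy (purified_oracle ev *v state ev \<delta> U q t)"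
    using U by (simp add: energy_unitary)
  also have "\<dots> \<le> (1 + ?c * (M / ?c))\<^sup>2 * energy (state ev \<delta> U q t)"
  proof (rule energy_oracle[OF assms(1)])
    show "slice (state ev \<delta> U q t) a \<in> reach_space ev \<delta> t" for a
      by (rule slice_state_reach_space[OF assms(1)])
    show "0 \<le> M / ?c" using \<open>0 \<le> M\<close> c by (rule divide_nonneg_pos)
  qed (rule bound[unfolded A_def])
  also have "?c * (M / ?c) = M" using assms(2) by simp
  \<comment> \<open>If the denominator were zero, the quotient would be 0 by convention and the
    bound would still hold.\<close>
  finally have "energy (state ev \<delta> U q (t + 1)) / energy (state ev \<delta> U q t) \<le> (1 + M)\<^sup>2"
    using energy_nonneg[of "state ev \<delta> U q t"]
    by (cases "energy (state ev \<delta> U q t) = 0") (simp_all add: divide_le_eq)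
  then have "progress ev \<delta> \<Gamma> U q (t + 1) / progress ev \<delta> \<Gamma> U q t \<le> of_real ((1 + M)\<^sup>2)"
    unfolding progress_eq_energy of_real_divide[symmetric] less_eq_complex_def by simp
  then show "progress ev \<delta> \<Gamma> U q (t + 1) / progress ev \<delta> \<Gamma> U q t
      \<le> of_real ((1 + Max {(\<kappa> - 1) / sqrt \<kappa> *
            opnorm (\<Lambda> (i + 1) ** reach_proj ev \<delta> (t + 1) ** phase_oracle ev x y
                      ** reach_proj ev \<delta> t ** \<Lambda> i) |i x y. i < l})\<^sup>2)"
    unfolding M_def A_def .
next
  interpret mla ev \<delta> \<kappa> l \<Lambda> \<Gamma> by unfold_locales (rule assms(3))
  fix T and U :: "nat \<Rightarrow> complex ^ (('z \<times> 'v::finite) \<times> 'x \<times> 'm mod_ring)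
    ^ (('z \<times> 'v) \<times> 'x \<times> 'm mod_ring)" and q
  assume U: "query_algorithm T U \<and> solves ev \<delta> F T U q (1 - \<epsilon>)"
  then have "1 + (lam - 1) * (sqrt (1 - \<epsilon>) - sqrt \<eta>)\<^sup>2 \<le> energy (state ev \<delta> U q T)"
    by (intro energy_ge_of_success[OF assms(5) _ _ assms(9,10,11)])
      (auto simp: solves_def norm_state)
  then show "progress ev \<delta> \<Gamma> U q T \<ge> of_real (1 + (lam - 1) * (sqrt (1 - \<epsilon>) - sqrt \<eta>)\<^sup>2)"
    unfolding progress_eq_energy less_eq_complex_def by simp
qed

end
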